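(* Let $\alpha$ be an infinite ordinal. There is an algebra in $\mathsf{RCA}_\alpha$ which is not endo-dimension-complemented, but each algebra in $\mathsf{RCA}_\alpha$ can be embedded into an endo-dimension-complemented algebra. In symbols: $\mathsf{Edc}_\alpha\subset\mathbf{S}\,\mathsf{Edc}_\alpha=\mathsf{RCA}_\alpha$, where $\subset$ denotes proper inclusion.
   Context: A cylindric algebra of dimension $\alpha$ (a $\mathsf{CA}_\alpha$) is an algebra $\langle A,+,-,c_i,d_{ij}: i,j\in\alpha\rangle$ such that $\langle A,+,-\rangle$ is a Boolean algebra and for all distinct $i,j,k\in\alpha$ and all $x,y\in A$: $c_ic_jx=c_jc_ix$, $x\le c_ix=c_ic_ix$, $c_i(x+y)=c_ix+c_iy$, $c_i-c_ix=-c_ix$, $d_{ii}=1$, $d_{ij}=d_{ji}$, $c_j(d_{ij}\cdot d_{jk})=d_{ik}$, $c_id_{ij}=1$, $d_{ij}\cdot c_i(d_{ij}\cdot x)=d_{ij}\cdot x$. For $V\subseteq{}^\alpha U$, the full cylindric set algebra with unit $V$ is $\langle \mathcal P(V),\cup,-,C_i^V,D_{ij}^V : i,j\in\alpha\rangle$, where $C_i^VX=\{s(i/u)\in V : s\in X,\ u\in U\}$ ($s(i/u)$ is $s$ with its value at $i$ changed to $u$) and $D_{ij}^V=\{s\in V : s_i=s_j\}$. $\mathsf{RCA}_\alpha$ is the class of all algebras isomorphic to subalgebras of full cylindric set algebras whose unit is a disjoint union of sets of the form ${}^\alpha U$. For $\mathfrak A\in\mathsf{CA}_\alpha$ and $\Gamma\subseteq\alpha$,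 the $\Gamma$-reduct of $\mathfrak A$ is $\langle A,+,-,c_i,d_{ij}\rangle_{i,j\in\Gamma}$. An algebra $\mathfrak A\in\mathsf{CA}_\alpha$ is endo-dimension-complemented if for each finite $\Gamma\subseteq\alpha$ and each nonzero $x\in A$ there are $\kappa\in\alpha-\Gamma$ and an endomorphism $h$ of the $\Gamma$-reduct of $\mathfrak A$ such that $h(x)\neq0$ and $c_\kappa h(a)=h(a)$ for all $a\in A$. $\mathsf{Edc}_\alpha$ is the class of all endo-dimension-complemented $\mathsf{CA}_\alpha$s, and $\mathbf{S}\,\mathsf K$ is the class of all subalgebras of members of $\mathsf K$. *)

theory Defs
  imports Main "HOL-Library.FuncSet" "HOL-Library.Disjoint_Sets"
begin

text \<open>
  Algebras \<open>\<langle>A, +, -, c\<^sub>i, d\<^sub>i\<^sub>j\<rangle>\<close> of the similarity type of cylindric algebras. The dimension is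
  not part of the record: every notion below takes the set of relevant indices as an argument, and
  the operations with indices outside that set are ignored. In particular the \<open>\<Gamma>\<close>-reduct of an
  algebra is the same record, considered with the index set \<open>\<Gamma>\<close>.
\<close>

record ('a, 'i) cyl_structure =
  carrier :: "'a set"
  join :: "'a \<Rightarrow> 'a \<Rightarrow> 'a"  (infixl "\<oplus>\<index>" 65)
  compl :: "'a \<Rightarrow> 'a"  ("\<sim>\<index> _" [81] 80)
  cyl :: "'i \<Rightarrow> 'a \<Rightarrow> 'a"
  diag :: "'i \<Rightarrow> 'i \<Rightarrow> 'a"

definition meet :: "('a, 'i, 'm) cyl_structure_scheme \<Rightarrow> 'a \<Rightarrow> 'a \<Rightarrow> 'a"  (infixl "\<odot>\<index>" 70)
  where "x \<odot>\<^bsub>A\<^esub> y = \<sim>\<^bsub>A\<^esub> (\<sim>\<^bsub>A\<^esub> x \<oplus>\<^bsub>A\<^esub> \<sim>\<^bsub>A\<^esub> y)"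

definition below :: "('a, 'i, 'm) cyl_structure_scheme \<Rightarrow> 'a \<Rightarrow> 'a \<Rightarrow> bool"  (infix "\<sqsubseteq>\<index>" 50)
  where "x \<sqsubseteq>\<^bsub>A\<^esub> y \<longleftrightarrow> x \<oplus>\<^bsub>A\<^esub> y = y"

text \<open>
  The signature has no constants \<open>0\<close> and \<open>1\<close>; as usual, \<open>1\<close> is the common value of the terms
  \<open>x + -x\<close>.
\<close>

definition top_el :: "('a, 'i, 'm) cyl_structure_scheme \<Rightarrow> 'a"  ("\<one>\<index>")
  where "\<one>\<^bsub>A\<^esub> = (THE e. \<forall>x\<in>carrier A. x \<oplus>\<^bsub>A\<^esub> \<sim>\<^bsub>A\<^esub> x = e)"

definition bot_el :: "('a, 'i, 'm) cyl_structure_scheme \<Rightarrow> 'a"  ("\<zero>\<index>")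
  where "\<zero>\<^bsub>A\<^esub> = \<sim>\<^bsub>A\<^esub> \<one>\<^bsub>A\<^esub>"

definition closed_under :: "'i set \<Rightarrow> ('a, 'i, 'm) cyl_structure_scheme \<Rightarrow> 'a set \<Rightarrow> bool"
  where "closed_under \<alpha> A S \<longleftrightarrow>
    (\<forall>x\<in>S. \<forall>y\<in>S. x \<oplus>\<^bsub>A\<^esub> y \<in> S) \<and>
    (\<forall>x\<in>S. \<sim>\<^bsub>A\<^esub> x \<in> S) \<and>
    (\<forall>i\<in>\<alpha>. \<forall>x\<in>S. cyl A i x \<in> S) \<and>
    (\<forall>i\<in>\<alpha>. \<forall>j\<in>\<alpha>. diag A i j \<in> S)"

definition cyl_type_algebra :: "'i set \<Rightarrow> ('a, 'i, 'm) cyl_structure_scheme \<Rightarrow> bool"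
  where "cyl_type_algebra \<alpha> A \<longleftrightarrow> carrier A \<noteq> {} \<and> closed_under \<alpha> A (carrier A)"

locale boolean_algebra_on =
  fixes A :: "('a, 'i, 'm) cyl_structure_scheme" (structure)
  assumes nonempty: "carrier A \<noteq> {}"
    and join_closed: "\<lbrakk>x \<in> carrier A; y \<in> carrier A\<rbrakk> \<Longrightarrow> x \<oplus> y \<in> carrier A"
    and compl_closed: "x \<in> carrier A \<Longrightarrow> \<sim> x \<in> carrier A"
    and join_assoc: "\<lbrakk>x \<in> carrier A; y \<in> carrier A; z \<in> carrier A\<rbrakk> \<Longrightarrow> (x \<oplus> y) \<oplus> z = x \<oplus> (y \<oplus> z)"
    and meet_assoc: "\<lbrakk>x \<in> carrier A; y \<in> carrier A; z \<in> carrier A\<rbrakk> \<Longrightarrow> (x \<odot> y) \<odot> z = x \<odot> (y \<odot> z)"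
    and join_comm: "\<lbrakk>x \<in> carrier A; y \<in> carrier A\<rbrakk> \<Longrightarrow> x \<oplus> y = y \<oplus> x"
    and meet_comm: "\<lbrakk>x \<in> carrier A; y \<in> carrier A\<rbrakk> \<Longrightarrow> x \<odot> y = y \<odot> x"
    and join_absorb: "\<lbrakk>x \<in> carrier A; y \<in> carrier A\<rbrakk> \<Longrightarrow> x \<oplus> (x \<odot> y) = x"
    and meet_absorb: "\<lbrakk>x \<in> carrier A; y \<in> carrier A\<rbrakk> \<Longrightarrow> x \<odot> (x \<oplus> y) = x"
    and join_distrib:
      "\<lbrakk>x \<in> carrier A; y \<in> carrier A; z \<in> carrier A\<rbrakk> \<Longrightarrow> x \<oplus> (y \<odot> z) = (x \<oplus> y) \<odot> (x \<oplus> z)"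
    and meet_distrib:
      "\<lbrakk>x \<in> carrier A; y \<in> carrier A; z \<in> carrier A\<rbrakk> \<Longrightarrow> x \<odot> (y \<oplus> z) = (x \<odot> y) \<oplus> (x \<odot> z)"
    and join_compl: "x \<in> carrier A \<Longrightarrow> x \<oplus> \<sim> x = \<one>"
    and meet_compl: "x \<in> carrier A \<Longrightarrow> x \<odot> \<sim> x = \<zero>"

locale cylindric_algebra = boolean_algebra_on A
  for \<alpha> :: "'i set" and A :: "('a, 'i, 'm) cyl_structure_scheme" (structure) +
  assumes cyl_closed: "\<lbrakk>i \<in> \<alpha>; x \<in> carrier A\<rbrakk> \<Longrightarrow> cyl A i x \<in> carrier A"
    and diag_closed: "\<lbrakk>i \<in> \<alpha>; j \<in> \<alpha>\<rbrakk> \<Longrightarrow> diag A i j \<in> carrier A"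
    and cyl_commute:
      "\<lbrakk>i \<in> \<alpha>; j \<in> \<alpha>; i \<noteq> j; x \<in> carrier A\<rbrakk> \<Longrightarrow> cyl A i (cyl A j x) = cyl A j (cyl A i x)"
    and cyl_increasing: "\<lbrakk>i \<in> \<alpha>; x \<in> carrier A\<rbrakk> \<Longrightarrow> x \<sqsubseteq> cyl A i x"
    and cyl_idem: "\<lbrakk>i \<in> \<alpha>; x \<in> carrier A\<rbrakk> \<Longrightarrow> cyl A i x = cyl A i (cyl A i x)"
    and cyl_join:
      "\<lbrakk>i \<in> \<alpha>; x \<in> carrier A; y \<in> carrier A\<rbrakk> \<Longrightarrow> cyl A i (x \<oplus> y) = cyl A i x \<oplus> cyl A i y"
    and cyl_compl: "\<lbrakk>i \<in> \<alpha>; x \<in> carrier A\<rbrakk> \<Longrightarrow> cyl A i (\<sim> cyl A i x) = \<sim> cyl A i x"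
    and diag_refl: "i \<in> \<alpha> \<Longrightarrow> diag A i i = \<one>"
    and diag_sym: "\<lbrakk>i \<in> \<alpha>; j \<in> \<alpha>; i \<noteq> j\<rbrakk> \<Longrightarrow> diag A i j = diag A j i"
    and diag_trans:
      "\<lbrakk>i \<in> \<alpha>; j \<in> \<alpha>; k \<in> \<alpha>; i \<noteq> j; j \<noteq> k; i \<noteq> k\<rbrakk>
        \<Longrightarrow> cyl A j (diag A i j \<odot> diag A j k) = diag A i k"
    and cyl_diag: "\<lbrakk>i \<in> \<alpha>; j \<in> \<alpha>; i \<noteq> j\<rbrakk> \<Longrightarrow> cyl A i (diag A i j) = \<one>"
    and diag_cyl:
      "\<lbrakk>i \<in> \<alpha>; j \<in> \<alpha>; i \<noteq> j; x \<in> carrier A\<rbrakk>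
        \<Longrightarrow> diag A i j \<odot> cyl A i (diag A i j \<odot> x) = diag A i j \<odot> x"

text \<open>
  Homomorphisms with respect to the operations with indices in \<open>\<Gamma>\<close>, i.e. homomorphisms between the
  \<open>\<Gamma>\<close>-reducts.
\<close>

definition cyl_hom ::
    "'i set \<Rightarrow> ('a, 'i) cyl_structure \<Rightarrow> ('b, 'i) cyl_structure \<Rightarrow> ('a \<Rightarrow> 'b) set"
  where "cyl_hom \<Gamma> A B = {h \<in> carrier A \<rightarrow> carrier B.
    (\<forall>x\<in>carrier A. \<forall>y\<in>carrier A. h (x \<oplus>\<^bsub>A\<^esub> y) = h x \<oplus>\<^bsub>B\<^esub> h y) \<and>
    (\<forall>x\<in>carrier A. h (\<sim>\<^bsub>A\<^esub> x) = \<sim>\<^bsub>B\<^esub> h x) \<and>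
    (\<forall>i\<in>\<Gamma>. \<forall>x\<in>carrier A. h (cyl A i x) = cyl B i (h x)) \<and>
    (\<forall>i\<in>\<Gamma>. \<forall>j\<in>\<Gamma>. h (diag A i j) = diag B i j)}"

definition cyl_iso :: "'i set \<Rightarrow> ('a, 'i) cyl_structure \<Rightarrow> ('b, 'i) cyl_structure \<Rightarrow> bool"
  where "cyl_iso \<alpha> A B \<longleftrightarrow> cyl_type_algebra \<alpha> A \<and> cyl_type_algebra \<alpha> B \<and>
    (\<exists>h \<in> cyl_hom \<alpha> A B. bij_betw h (carrier A) (carrier B))"

text \<open>
  The class operators \<open>\<^bold>I\<close> and \<open>\<^bold>S\<close>. The two carrier types of \<open>\<^bold>I\<close> are
  independent, so that it also moves algebras from one carrier type to another.
\<close>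

definition Iso :: "'i set \<Rightarrow> ('b, 'i) cyl_structure set \<Rightarrow> ('a, 'i) cyl_structure set"
  where "Iso \<alpha> K = {A. \<exists>B\<in>K. cyl_iso \<alpha> A B}"

definition Sub :: "'i set \<Rightarrow> ('a, 'i) cyl_structure set \<Rightarrow> ('a, 'i) cyl_structure set"
  where "Sub \<alpha> K = {B\<lparr>carrier := S\<rparr> | B S.
    B \<in> K \<and> S \<subseteq> carrier B \<and> S \<noteq> {} \<and> closed_under \<alpha> B S}"

text \<open>
  Sequences in \<open>\<^sup>\<alpha>U\<close> are the functions in \<open>\<alpha> \<rightarrow>\<^sub>E U\<close>, fixed to be \<open>undefined\<close> outside of \<open>\<alpha>\<close>.
\<close>

definition full_cyl_set_algebra ::
    "'u set \<Rightarrow> ('i \<Rightarrow> 'u) set \<Rightarrow> (('i \<Rightarrow> 'u) set, 'i) cyl_structure"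
  where "full_cyl_set_algebra U V = \<lparr>
    carrier = Pow V,
    join = (\<union>),
    compl = (\<lambda>X. V - X),
    cyl = (\<lambda>i X. {s(i := u) | s u. s \<in> X \<and> u \<in> U \<and> s(i := u) \<in> V}),
    diag = (\<lambda>i j. {s \<in> V. s i = s j})\<rparr>"

text \<open>
  The members of \<open>RCA\<^sub>\<alpha>\<close> that are representable with base sets in the type \<open>'u\<close>; the proper class
  \<open>RCA\<^sub>\<alpha>\<close> is the union over all types \<open>'u\<close>.
\<close>

definition RCA :: "'u itself \<Rightarrow> 'i set \<Rightarrow> ('a, 'i) cyl_structure set"
  where "RCA (_ :: 'u itself) \<alpha> = Iso \<alpha> (Sub \<alpha>
    {full_cyl_set_algebra (\<Union>\<U>) (\<Union>U\<in>\<U>. \<alpha> \<rightarrow>\<^sub>E U) | \<U> :: 'u set set.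
      disjoint ((\<lambda>U. \<alpha> \<rightarrow>\<^sub>E U) ` \<U>)})"

definition endo_dimension_complemented :: "'i set \<Rightarrow> ('a, 'i) cyl_structure \<Rightarrow> bool"
  where "endo_dimension_complemented \<alpha> A \<longleftrightarrow>
    (\<forall>\<Gamma> x. \<Gamma> \<subseteq> \<alpha> \<and> finite \<Gamma> \<and> x \<in> carrier A \<and> x \<noteq> \<zero>\<^bsub>A\<^esub> \<longrightarrow>
      (\<exists>\<kappa>\<in>\<alpha> - \<Gamma>. \<exists>h\<in>cyl_hom \<Gamma> A A.
        h x \<noteq> \<zero>\<^bsub>A\<^esub> \<and> (\<forall>a\<in>carrier A. cyl A \<kappa> (h a) = h a)))"

definition Edc :: "'i set \<Rightarrow> ('a, 'i) cyl_structure set"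
  where "Edc \<alpha> = {A. cylindric_algebra \<alpha> A \<and> endo_dimension_complemented \<alpha> A}"

end

theory Submission
  imports Defs
begin

text \<open>
  A full cylindric set algebra whose unit is a disjoint union of squares is endo-dimension-complemented:
  replacing the coordinates outside \<open>\<Gamma>\<close> of a sequence by those of a fixed sequence from the same square
  is a homomorphism of the \<open>\<Gamma>\<close>-reduct. For the converse, iterating the given endomorphisms makes finitely
  many indices free for use as names of elements, which allows a Henkin construction with witnesses; only
  finitely many conditions matter at a time, and compactness yields a valuation satisfying all of them.
  The terms naming witnesses may refer to whole \<open>\<alpha>\<close>-sequences of names, so the base obtained is a full
  square and no weak spaces are needed. The counterexample to equality of the classes has more than \<open>|\<alpha>|\<close>
  disjoint elements with a common cylindrification, separated only on injective sequences.
\<close>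

section \<open>Cylindric set algebras\<close>

text \<open>No single endomorphism serves all of \<alpha>: each finite index set has its own, and
  they need not be compatible. So the limit is taken of truth valuations, not of endomorphisms. An
  index \<kappa> fixed by the whole image of an endomorphism acts as a fresh constant. If \<kappa>
  affects neither y nor e, the Henkin condition t = -c_i y + s^i_\<kappa> y has c_\<kappa> t = 1,
  hence c_\<kappa>(t.e) = e, and imposing t on a nonzero e leaves it nonzero. The delicate point is
  the quotient by equality of names. Equals may be replaced at one coordinate, but an element can
  depend on infinitely many, and infinitely many replacements at once are not justified. Sequences
  of representatives are therefore read back as names, coordinate by coordinate, in such a way that
  the initial sequence of constants is recovered exactly. In the counterexample the colours form a
  power set because Cantor's theorem then excludes matching them with the values that occur in one
  sequence.\<close>

locale cyl_set_unit =
  fixes I :: "'i set" and \<U> :: "'u set set"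
  assumes infinite_index: "infinite I"
    and disjoint_squares: "disjoint ((\<lambda>U. I \<rightarrow>\<^sub>E U) ` \<U>)"
begin

definition V :: "('i \<Rightarrow> 'u) set"
  where "V = (\<Union>U\<in>\<U>. I \<rightarrow>\<^sub>E U)"

definition \<A> :: "(('i \<Rightarrow> 'u) set, 'i) cyl_structure"
  where "\<A> = full_cyl_set_algebra (\<Union>\<U>) V"

lemma full_simps [simp]:
  "carrier \<A> = Pow V" "join \<A> X Y = X \<union> Y" "compl \<A> X = V - X" "diag \<A> i j = {s \<in> V. s i = s j}"
  by (simp_all add: \<A>_def full_cyl_set_algebra_def)

text \<open>A second coordinate \<open>j\<close> keeps its value, so a constant sequence with value
  \<open>s j\<close> lies in both squares, and disjointness makes them equal: changing one
  coordinate never leads from one square into another.\<close>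

lemma upd_in_square:
  assumes s: "s \<in> I \<rightarrow>\<^sub>E U" "U \<in> \<U>" and i: "i \<in> I" and su: "s(i := u) \<in> V"
  shows "u \<in> U"
proof -
  from su obtain W where W: "W \<in> \<U>" "s(i := u) \<in> I \<rightarrow>\<^sub>E W"
    by (auto simp: V_def)
  obtain j where j: "j \<in> I" "j \<noteq> i"
    using infinite_index by (metis finite.emptyI finite_insert finite_subset insertI1 subsetI)
  have "s j \<in> W"
    using W(2) j by (metis PiE_mem fun_upd_apply)
  moreover have "s j \<in> U"
    using s j by auto
  ultimately have "restrict (\<lambda>_. s j) I \<in> (I \<rightarrow>\<^sub>E U) \<inter> (I \<rightarrow>\<^sub>E W)"
    by auto
  then have "(I \<rightarrow>\<^sub>E U) = (I \<rightarrow>\<^sub>E W)"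
    using disjoint_squares s(2) W(1) by (metis disjointD emptyE imageI)
  then show ?thesis
    using W(2) i by (metis PiE_mem fun_upd_same)
qed

lemma upd_upd_V:
  assumes "s \<in> V" "i \<in> I" "j \<in> I" "s(i := u) \<in> V" "s(j := w) \<in> V"
  shows "s(i := u, j := w) \<in> V"
proof -
  obtain U where U: "U \<in> \<U>" "s \<in> I \<rightarrow>\<^sub>E U"
    using assms(1) by (auto simp: V_def)
  have "u \<in> U" "w \<in> U"
    using upd_in_square[OF U(2,1)] assms by blast+
  then have "s(i := u, j := w) \<in> I \<rightarrow>\<^sub>E U"
    using U(2) assms(2,3) by (auto simp: PiE_iff extensional_def)
  then show ?thesis
    using U(1) by (auto simp: V_def)
qed

lemma copy_V:
  assumes "s \<in> V" "i \<in> I" "j \<in> I"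
  shows "s(i := s j) \<in> V"
proof -
  obtain U where "U \<in> \<U>" "s \<in> I \<rightarrow>\<^sub>E U"
    using assms(1) by (auto simp: V_def)
  then show ?thesis
    using assms unfolding V_def by (intro UN_I[of U]) (auto simp: PiE_iff extensional_def)
qed

text \<open>Undoing the change, \<open>s = (s(i := u))(i := s i)\<close>, turns the image into a
  membership condition; \<open>s \<in> V\<close> already bounds the value put back.\<close>

lemma cyl_full:
  assumes "i \<in> I" "X \<subseteq> V"
  shows "cyl \<A> i X = {s \<in> V. \<exists>u. s(i := u) \<in> X}"
proof -
  have "s \<in> cyl \<A> i X" if "s \<in> V" "s(i := u) \<in> X" for s u
  proof -
    have "s i \<in> \<Union>\<U>"
      using that(1) assms(1) by (auto simp: V_def)
    moreover have "s = (s(i := u))(i := s i)"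
      by simp
    ultimately show ?thesis
      using that unfolding \<A>_def full_cyl_set_algebra_def by (simp, metis)
  qed
  moreover have "\<exists>w. (s(i := u))(i := w) \<in> X" if "s \<in> X" for s u
    using that by (intro exI[of _ "s i"]) simp
  ultimately show ?thesis
    by (auto simp: \<A>_def full_cyl_set_algebra_def)
qed

lemma cyl_full_subset: "\<lbrakk>i \<in> I; X \<subseteq> V\<rbrakk> \<Longrightarrow> cyl \<A> i X \<subseteq> V"
  by (auto simp: cyl_full)

lemma top_full: "top_el \<A> = V"
  unfolding top_el_def by (rule the_equality) auto

lemma bot_full: "bot_el \<A> = {}"
  by (simp add: bot_el_def top_full)

lemma meet_full: "\<lbrakk>X \<subseteq> V; Y \<subseteq> V\<rbrakk> \<Longrightarrow> meet \<A> X Y = X \<inter> Y"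
  by (auto simp: meet_def)

lemma cylindric_full: "cylindric_algebra I \<A>"
proof unfold_locales
  fix i j X assume ij: "i \<in> I" "j \<in> I" "i \<noteq> j" and X: "X \<in> carrier \<A>"
  have "cyl \<A> i (cyl \<A> j X) \<subseteq> cyl \<A> j (cyl \<A> i X)" if ij: "i \<in> I" "j \<in> I" "i \<noteq> j" for i j
  proof
    have XV: "X \<subseteq> V"
      using X by simp
    fix s assume "s \<in> cyl \<A> i (cyl \<A> j X)"
    then obtain u where u: "s \<in> V" "s(i := u) \<in> cyl \<A> j X"
      unfolding cyl_full[OF ij(1) cyl_full_subset[OF ij(2) XV]] by blast
    then obtain w where w: "s(i := u) \<in> V" "s(i := u, j := w) \<in> X"
      unfolding cyl_full[OF ij(2) XV] by blast
    \<comment> \<open>Two changes are permitted from \<open>s(i := u)\<close>: putting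
      \<open>w\<close> at \<open>j\<close>, and restoring \<open>s i\<close> at \<open>i\<close>.
      Together they give \<open>s(j := w)\<close>, the intermediate sequence for the other
      order.\<close>
    have "s(i := u, j := w, i := s i) \<in> V"
      using upd_upd_V[of "s(i := u)" j i w "s i"] w u ij XV by auto
    moreover have "s(i := u, j := w, i := s i) = s(j := w)"
      using ij(3) by auto
    ultimately have "s(j := w) \<in> V"
      by simp
    moreover have "s(j := w, i := u) \<in> X"
      using w(2) fun_upd_twist[OF ij(3)] by metis
    ultimately have "s(j := w) \<in> cyl \<A> i X"
      unfolding cyl_full[OF ij(1) XV] by blast
    then show "s \<in> cyl \<A> j (cyl \<A> i X)"
      unfolding cyl_full[OF ij(2) cyl_full_subset[OF ij(1) XV]] using u(1) by blast
  qed
  then show "cyl \<A> i (cyl \<A> j X) = cyl \<A> j (cyl \<A> i X)"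
    using ij by blast
next
  fix i j k assume *: "i \<in> I" "j \<in> I" "k \<in> I" "i \<noteq> j" "j \<noteq> k" "i \<noteq> k"
  show "cyl \<A> j (diag \<A> i j \<odot>\<^bsub>\<A>\<^esub> diag \<A> j k) = diag \<A> i k"
  proof -
    have "diag \<A> i j \<odot>\<^bsub>\<A>\<^esub> diag \<A> j k = {s \<in> V. s i = s j \<and> s j = s k}"
      by (subst meet_full) auto
    moreover have "cyl \<A> j {s \<in> V. s i = s j \<and> s j = s k} = {s \<in> V. s i = s k}"
    proof (subst cyl_full)
      show "{s \<in> V. \<exists>u. s(j := u) \<in> {s \<in> V. s i = s j \<and> s j = s k}} = {s \<in> V. s i = s k}"
        using * copy_V[OF _ *(2,1)] by fastforce
    qed (use * in auto)
    ultimately show ?thesis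
      by simp
  qed
next
  fix i j assume *: "i \<in> I" "j \<in> I" "i \<noteq> j"
  show "cyl \<A> i (diag \<A> i j) = \<one>\<^bsub>\<A>\<^esub>"
  proof -
    have "{s \<in> V. \<exists>u. s(i := u) \<in> {s \<in> V. s i = s j}} = V"
      using * copy_V[OF _ *(1,2)] by fastforce
    moreover have "{s \<in> V. s i = s j} \<subseteq> V"
      by auto
    ultimately show ?thesis
      unfolding top_full full_simps using cyl_full[OF *(1)] by simp
  qed
  fix X assume X: "X \<in> carrier \<A>"
  show "diag \<A> i j \<odot>\<^bsub>\<A>\<^esub> cyl \<A> i (diag \<A> i j \<odot>\<^bsub>\<A>\<^esub> X) = diag \<A> i j \<odot>\<^bsub>\<A>\<^esub> X"
  proof -
    have m: "diag \<A> i j \<odot>\<^bsub>\<A>\<^esub> X = {s \<in> V. s i = s j} \<inter> X"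
      using X by (subst meet_full) auto
    have XV: "X \<subseteq> V" and dV: "{s \<in> V. s i = s j} \<inter> X \<subseteq> V"
      using X by auto
    show ?thesis
      unfolding m
    proof (subst meet_full)
      show "diag \<A> i j \<inter> cyl \<A> i ({s \<in> V. s i = s j} \<inter> X) = {s \<in> V. s i = s j} \<inter> X"
      proof (intro equalityI subsetI)
        fix s assume "s \<in> {s \<in> V. s i = s j} \<inter> X"
        moreover from this have "s(i := s j) = s"
          by (metis (mono_tags, lifting) IntD1 fun_upd_triv mem_Collect_eq)
        ultimately have "s \<in> V" "s i = s j" "s(i := s j) \<in> {s \<in> V. s i = s j} \<inter> X"
          by auto
        then show "s \<in> diag \<A> i j \<inter> cyl \<A> i ({s \<in> V. s i = s j} \<inter> X)"
          unfolding cyl_full[OF *(1) dV] full_simps by blast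
      next
        fix s assume "s \<in> diag \<A> i j \<inter> cyl \<A> i ({s \<in> V. s i = s j} \<inter> X)"
        then obtain u where u: "s \<in> V" "s i = s j" "s(i := u) \<in> X" "u = s j"
          unfolding cyl_full[OF *(1) dV] full_simps using *(3) by auto
        then have "s(i := u) = s"
          by auto
        then show "s \<in> {s \<in> V. s i = s j} \<inter> X"
          using u by simp
      qed
    qed (use dV cyl_full_subset[OF *(1) dV] in auto)
  qed
next
  fix i X assume i: "i \<in> I" and X: "X \<in> carrier \<A>"
  then have XV: "X \<subseteq> V"
    by simp
  note c = cyl_full[OF i XV] cyl_full[OF i cyl_full_subset[OF i XV]]
  show le: "X \<sqsubseteq>\<^bsub>\<A>\<^esub> cyl \<A> i X"
  proof -
    have "s \<in> cyl \<A> i X" if "s \<in> X" for s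
      unfolding c(1) using that XV by (auto intro!: exI[of _ "s i"])
    then show ?thesis
      by (auto simp: below_def)
  qed
  show "cyl \<A> i X = cyl \<A> i (cyl \<A> i X)"
    unfolding c(2) unfolding c(1) using XV by auto
  have "V - cyl \<A> i X \<subseteq> V"
    by auto
  note c' = cyl_full[OF i this]
  show "cyl \<A> i (\<sim>\<^bsub>\<A>\<^esub> cyl \<A> i X) = \<sim>\<^bsub>\<A>\<^esub> cyl \<A> i X"
  proof -
    have "s \<in> cyl \<A> i (V - cyl \<A> i X)" if "s \<in> V - cyl \<A> i X" for s
      unfolding c' using that by (auto intro!: exI[of _ "s i"])
    moreover have "s \<in> V - cyl \<A> i X" if "s \<in> cyl \<A> i (V - cyl \<A> i X)" for s
      using that[unfolded c'] XV unfolding c(1) by auto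
    ultimately show ?thesis
      by auto
  qed
qed (auto simp: meet_def top_full bot_full cyl_full)

lemma edc_full: "endo_dimension_complemented I \<A>"
  unfolding endo_dimension_complemented_def
proof (intro allI impI, elim conjE)
  fix \<Gamma> X assume \<Gamma>: "\<Gamma> \<subseteq> I" "finite \<Gamma>" and X: "X \<in> carrier \<A>" "X \<noteq> \<zero>\<^bsub>\<A>\<^esub>"
  obtain \<kappa> where \<kappa>: "\<kappa> \<in> I" "\<kappa> \<notin> \<Gamma>"
    using \<Gamma> infinite_index by (metis finite_subset subsetI)
  obtain s0 where s0: "s0 \<in> X" "s0 \<in> V"
    using X by (auto simp: bot_full)
  define blk where "blk t = (SOME B. B \<in> (\<lambda>U. I \<rightarrow>\<^sub>E U) ` \<U> \<and> t \<in> B)" for t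
  have blk: "blk t = I \<rightarrow>\<^sub>E U" if "t \<in> I \<rightarrow>\<^sub>E U" "U \<in> \<U>" for t U
  proof -
    have "blk t \<in> (\<lambda>U. I \<rightarrow>\<^sub>E U) ` \<U> \<and> t \<in> blk t"
      unfolding blk_def by (rule someI[of _ "I \<rightarrow>\<^sub>E U"]) (use that in blast)
    then show ?thesis
      using disjointD[OF disjoint_squares _ imageI[OF that(2)], of "blk t"] that(1) by blast
  qed
  \<comment> \<open>The reference sequence depends on \<open>t\<close> only through its square, so
    changes of single coordinates within the unit do not affect it. In the square of
    \<open>s0\<close> it is \<open>s0\<close> itself, which gives \<open>m s0 = s0\<close> and keeps
    \<open>h X\<close> nonempty.\<close>
  define G where "G t = (if s0 \<in> blk t then s0 else (SOME s. s \<in> blk t))" for t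
  define m where "m t k = (if k \<in> \<Gamma> then t k else G t k)" for t k
  define h where "h X = {t \<in> V. m t \<in> X}" for X
  have m_square: "m t \<in> I \<rightarrow>\<^sub>E U" if "t \<in> I \<rightarrow>\<^sub>E U" "U \<in> \<U>" for t U
  proof -
    have "G t \<in> blk t"
      unfolding G_def blk[OF that] using that(1) by (metis someI)
    then show ?thesis
      using blk[OF that] that \<Gamma> by (auto simp: m_def PiE_iff extensional_def)
  qed
  then have m_V: "m t \<in> V" if "t \<in> V" for t
    using that by (auto simp: V_def)
  have m_upd: "m (t(i := u)) = (if i \<in> \<Gamma> then (m t)(i := u) else m t)"
    if t: "t \<in> V" "t(i := u) \<in> V" "i \<in> I" for t i u
  proof -
    obtain U where U: "U \<in> \<U>" "t \<in> I \<rightarrow>\<^sub>E U"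
      using t by (auto simp: V_def)
    then have "t(i := u) \<in> I \<rightarrow>\<^sub>E U"
      using t upd_in_square[OF U(2,1)] by (auto simp: PiE_iff extensional_def)
    then have "G (t(i := u)) = G t"
      using U blk by (metis G_def)
    then show ?thesis
      by (auto simp: m_def fun_eq_iff)
  qed
  have "h \<in> cyl_hom \<Gamma> \<A> \<A>"
    unfolding cyl_hom_def
  proof (intro CollectI conjI ballI)
    fix i Y assume i: "i \<in> \<Gamma>" and Y: "Y \<in> carrier \<A>"
    have iI: "i \<in> I"
      using i \<Gamma> by auto
    have hY: "h Y \<subseteq> V"
      by (auto simp: h_def)
    have "t(i := u) \<in> V" if t: "t \<in> V" "(m t)(i := u) \<in> Y" for t u
    proof -
      obtain U where U: "U \<in> \<U>" "t \<in> I \<rightarrow>\<^sub>E U"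
        using t by (auto simp: V_def)
      have "u \<in> U"
        using upd_in_square[OF m_square[OF U(2,1)] U(1) iI] t Y by auto
      then show ?thesis
        using U iI unfolding V_def by (intro UN_I[of U]) (auto simp: PiE_iff extensional_def)
    qed
    then have "(\<exists>u. (m t)(i := u) \<in> Y) \<longleftrightarrow> (\<exists>u. t(i := u) \<in> V \<and> m (t(i := u)) \<in> Y)" if "t \<in> V" for t
      using that i m_upd[of t i] iI by metis
    then have "t \<in> h (cyl \<A> i Y) \<longleftrightarrow> t \<in> cyl \<A> i (h Y)" for t
      using Y iI hY by (auto simp: cyl_full h_def m_V)
    then show "h (cyl \<A> i Y) = cyl \<A> i (h Y)"
      by blast
  qed (use m_V in \<open>auto simp: h_def m_def\<close>)
  moreover have "s0 \<in> h X"
  proof -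
    have "s0 \<in> blk s0"
      using s0(2) blk by (auto simp: V_def)
    then have "m s0 = s0"
      by (auto simp: m_def G_def)
    then show ?thesis
      using s0 by (simp add: h_def)
  qed
  moreover have "cyl \<A> \<kappa> (h Y) = h Y" for Y
  proof -
    have "h Y \<subseteq> V"
      by (auto simp: h_def)
    moreover have "t \<in> h Y" if "t \<in> V" "t(\<kappa> := u) \<in> h Y" for t u
      using that m_upd[of t \<kappa> u] \<kappa> by (auto simp: h_def)
    moreover have "\<exists>u. t(\<kappa> := u) \<in> h Y" if "t \<in> h Y" for t
      using that by (metis fun_upd_triv)
    ultimately show ?thesis
      using \<kappa> by (auto simp: cyl_full)
  qed
  ultimately show "\<exists>\<kappa>\<in>I - \<Gamma>. \<exists>h\<in>cyl_hom \<Gamma> \<A> \<A>. h X \<noteq> \<zero>\<^bsub>\<A>\<^esub> \<and> (\<forall>a\<in>carrier \<A>. cyl \<A> \<kappa> (h a) = h a)"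
    using \<kappa> unfolding bot_full by (intro bexI[of _ \<kappa>] bexI[of _ h]) auto
qed

lemma full_in_Edc: "\<A> \<in> Edc I"
  by (simp add: Edc_def cylindric_full edc_full)

end

lemma RCA_subset_Iso_Sub_Edc:
  assumes "infinite I"
  shows "(RCA TYPE('u) I :: ('a, 'i) cyl_structure set)
    \<subseteq> Iso I (Sub I (Edc I :: (('i \<Rightarrow> 'u) set, 'i) cyl_structure set))"
proof -
  have "full_cyl_set_algebra (\<Union>\<U>) (\<Union>U\<in>\<U>. I \<rightarrow>\<^sub>E U) \<in> Edc I"
    if "disjoint ((\<lambda>U. I \<rightarrow>\<^sub>E U) ` \<U>)" for \<U> :: "'u set set"
  proof -
    interpret cyl_set_unit I \<U>
      using that assms by unfold_locales
    show ?thesis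
      using full_in_Edc by (simp add: V_def \<A>_def)
  qed
  then show ?thesis
    unfolding RCA_def Iso_def Sub_def by blast
qed

lemma cyl_iso_refl: "cyl_type_algebra I A \<Longrightarrow> cyl_iso I A A"
  unfolding cyl_iso_def cyl_hom_def by (auto intro!: exI[of _ id])

lemma Edc_subset_Iso_Sub_Edc:
  "(Edc I :: ('a, 'i) cyl_structure set) \<subseteq> Iso I (Sub I (Edc I :: ('a, 'i) cyl_structure set))"
proof
  fix A :: "('a, 'i) cyl_structure" assume A: "A \<in> Edc I"
  then interpret cylindric_algebra I A
    by (simp add: Edc_def)
  have cl: "carrier A \<noteq> {}" "closed_under I A (carrier A)"
    using nonempty join_closed compl_closed cyl_closed diag_closed by (auto simp: closed_under_def)
  then have "A\<lparr>carrier := carrier A\<rparr> \<in> Sub I (Edc I)"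
    using A unfolding Sub_def by blast
  moreover have "cyl_iso I A A"
    using cl by (intro cyl_iso_refl) (simp add: cyl_type_algebra_def)
  ultimately show "A \<in> Iso I (Sub I (Edc I :: ('a, 'i) cyl_structure set))"
    by (auto simp: Iso_def)
qed

section \<open>A representable algebra that is not endo-dimension-complemented\<close>

text \<open>Takes the parity of the number of places where \<open>f\<close> differs from a chosen
  member of its class modulo finite changes. This replaces the sum modulo 2 of infinitely many
  bits.\<close>

lemma ex_parity:
  "\<exists>p :: ('i \<Rightarrow> bool) \<Rightarrow> bool. \<forall>f i. p (f(i := \<not> f i)) \<longleftrightarrow> \<not> p f"
proof -
  define R :: "(('i \<Rightarrow> bool) \<times> ('i \<Rightarrow> bool)) set" where "R = {(f, g). finite {i. f i \<noteq> g i}}"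
  have tr: "finite {i. f i \<noteq> h i}" if "finite {i. f i \<noteq> g i}" "finite {i. g i \<noteq> h i}"
    for f g h :: "'i \<Rightarrow> bool"
    by (rule finite_subset[OF _ finite_UnI[OF that]]) auto
  define r where "r f = (SOME g. finite {i. f i \<noteq> g i})" for f :: "'i \<Rightarrow> bool"
  have r: "finite {i. f i \<noteq> r f i}" for f :: "'i \<Rightarrow> bool"
    unfolding r_def by (rule someI[of _ f]) simp
  have r_cong: "r f = r g" if "finite {i. f i \<noteq> g i}" for f g :: "'i \<Rightarrow> bool"
  proof -
    have "finite {i. g i \<noteq> f i}"
      using that by (simp add: eq_commute)
    then have "(\<lambda>h. finite {i. f i \<noteq> h i}) = (\<lambda>h. finite {i. g i \<noteq> h i})"
      using that tr by blast
    then show ?thesis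
      by (simp add: r_def)
  qed
  define p where "p f \<longleftrightarrow> even (card {i. f i \<noteq> r f i})" for f :: "'i \<Rightarrow> bool"
  have "p (f(i := \<not> f i)) \<longleftrightarrow> \<not> p f" for f i
  proof -
    define D D' where "D = {j. f j \<noteq> r f j}" and "D' = {j. (f(i := \<not> f i)) j \<noteq> r f j}"
    have "r (f(i := \<not> f i)) = r f"
      by (rule r_cong, rule finite_subset[of _ "{i}"]) auto
    then have p: "p (f(i := \<not> f i)) \<longleftrightarrow> even (card D')" "p f \<longleftrightarrow> even (card D)"
      by (simp_all add: p_def D_def D'_def)
    have fin: "finite D"
      using r by (simp add: D_def)
    show ?thesis
    proof (cases "i \<in> D")
      case True
      then have "D = insert i D'" "i \<notin> D'"
        by (auto simp: D_def D'_def)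
      then show ?thesis
        using fin p by simp
    next
      case False
      then have "D' = insert i D"
        by (auto simp: D_def D'_def)
      then show ?thesis
        using False fin p by simp
    qed
  qed
  then show ?thesis
    by blast
qed

lemma ex_pairing:
  assumes "infinite (UNIV :: 't set)"
  shows "\<exists>P :: 't \<Rightarrow> 't \<Rightarrow> 't. \<forall>a b c d. P a b = P c d \<longleftrightarrow> a = c \<and> b = d"
proof -
  obtain f :: "'t \<times> 't \<Rightarrow> 't" where "inj f"
    using card_of_Times_same_infinite[OF assms] card_of_ordIso[of "UNIV \<times> UNIV :: ('t \<times> 't) set" "UNIV :: 't set"]
    by (metis UNIV_Times_UNIV bij_betw_imp_inj_on)
  then show ?thesis
    by (intro exI[of _ "\<lambda>a b. f (a, b)"]) (auto dest: injD)
qed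

text \<open>The tags \<open>undefined\<close> and \<open>c1\<close> give two coded halves of a set.
  One stores \<open>G\<close>; the other is filled with Cantor's diagonal set, so that the result
  differs from every \<open>f x\<close>.\<close>

lemma ex_large_fibres:
  assumes "infinite (UNIV :: 'i set)"
  shows "\<exists>g :: 'i set \<Rightarrow> 'i set. \<forall>G (f :: 'i \<Rightarrow> 'i set). \<exists>S. g S = G \<and> S \<notin> range f"
proof -
  obtain P :: "'i \<Rightarrow> 'i \<Rightarrow> 'i" where P: "\<And>a b c d. P a b = P c d \<longleftrightarrow> a = c \<and> b = d"
    using ex_pairing[OF assms] by blast
  obtain c1 :: 'i where "c1 \<notin> {undefined}"
    using ex_new_if_finite[OF assms, of "{undefined}"] by blast
  then have c: "undefined \<noteq> c1"
    by auto
  define g where "g S = P undefined -` S" for S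
  have "\<exists>S. g S = G \<and> S \<notin> range f" for G and f :: "'i \<Rightarrow> 'i set"
  proof -
    define C where "C = {x. P c1 x \<notin> f x}"
    then have C: "C \<noteq> P c1 -` f x" for x
      by auto
    let ?S = "P undefined ` G \<union> P c1 ` C"
    have "g ?S = G" "P c1 -` ?S = C"
      using c P by (auto simp: g_def)
    moreover from this C have "?S \<noteq> f x" for x
      by metis
    ultimately show ?thesis
      by (intro exI[of _ ?S] conjI) (simp_all add: image_iff)
  qed
  then show ?thesis
    by blast
qed

text \<open>For each \<open>a\<close>, the colour bit at \<open>a\<close> is the parity over
  \<open>k\<close> of whether \<open>a\<close> lies in \<open>g (t k)\<close>. One coordinate
  controls all bits at once because \<open>g u\<close> can be prescribed, and the large fibres of
  \<open>g\<close> leave room to avoid \<open>range f\<close>.\<close>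

lemma ex_balanced_colouring:
  assumes "infinite (UNIV :: 'i set)"
  shows "\<exists>X :: ('i \<Rightarrow> 'i set) \<Rightarrow> 'i set. \<forall>t i j (f :: 'i \<Rightarrow> 'i set). \<exists>u. X (t(i := u)) = j \<and> u \<notin> range f"
proof -
  from ex_large_fibres[OF assms] obtain g :: "'i set \<Rightarrow> 'i set"
    where g: "\<forall>G (f :: 'i \<Rightarrow> 'i set). \<exists>S. g S = G \<and> S \<notin> range f" ..
  from ex_parity obtain p :: "('i \<Rightarrow> bool) \<Rightarrow> bool" where p: "\<forall>f i. p (f(i := \<not> f i)) \<longleftrightarrow> \<not> p f" ..
  define X where "X t = {a. p (\<lambda>i. a \<in> g (t i))}" for t
  have "\<exists>u. X (t(i := u)) = j \<and> u \<notin> range f" for t i j and f :: "'i \<Rightarrow> 'i set"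
  proof -
    let ?b = "\<lambda>a. \<lambda>k. a \<in> g (t k)"
    obtain u where u: "g u = {a. p ((?b a)(i := True)) \<longleftrightarrow> a \<in> j}" "u \<notin> range f"
      using g[rule_format, of "{a. p ((?b a)(i := True)) \<longleftrightarrow> a \<in> j}" f] by (elim exE conjE) (rule that)
    have "(\<lambda>k. a \<in> g ((t(i := u)) k)) = (?b a)(i := a \<in> g u)" for a
      by auto
    moreover have "p ((?b a)(i := False)) \<longleftrightarrow> \<not> p ((?b a)(i := True))" for a
      using p[rule_format, of "(?b a)(i := True)" i] by simp
    ultimately have "a \<in> X (t(i := u)) \<longleftrightarrow> a \<in> j" for a
      unfolding X_def u by (cases "p ((?b a)(i := True)) \<longleftrightarrow> a \<in> j") simp_all
    then show ?thesis
      using u(2) by blast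
  qed
  then show ?thesis
    by blast
qed

section \<open>The subalgebra of elements that see colours on injective sequences only\<close>

locale colouring = cyl_set_unit I "{UNIV :: 'i set set}" for I :: "'i set" +
  fixes X :: "('i \<Rightarrow> 'i set) \<Rightarrow> 'i set"
  assumes X: "\<And>t i j (f :: 'i \<Rightarrow> 'i set). \<exists>u. X (t(i := u)) = j \<and> u \<notin> range f"
begin

lemma V_UNIV: "V = extensional I"
  by (auto simp: V_def PiE_def)

lemma upd_V [simp]: "s \<in> V \<Longrightarrow> i \<in> I \<Longrightarrow> s(i := u) \<in> V"
  by (auto simp: V_UNIV extensional_def)

text \<open>
  Noninjective sequences see only the pattern of equalities outside \<open>F\<close>; on injective ones the
  colour \<open>X\<close> is visible as well. Elements invariant under \<open>sim F\<close> for all large finite \<open>F\<close> form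
  a subalgebra, because colours can be corrected by changing a single coordinate.
\<close>

definition sim :: "'i set \<Rightarrow> ('i \<Rightarrow> 'i set) \<Rightarrow> ('i \<Rightarrow> 'i set) \<Rightarrow> bool"
  where "sim F s s' \<longleftrightarrow> (\<forall>k\<in>I - F. s k = s' k) \<and> (\<forall>k\<in>I. \<forall>l\<in>I. s k = s l \<longleftrightarrow> s' k = s' l) \<and>
    (inj_on s I \<longrightarrow> X s = X s')"

definition invar :: "('i \<Rightarrow> 'i set) set \<Rightarrow> bool"
  where "invar Y \<longleftrightarrow> (\<exists>F. finite F \<and> (\<forall>F' s s'. finite F' \<longrightarrow> F \<subseteq> F' \<longrightarrow> s \<in> V \<longrightarrow> s' \<in> V \<longrightarrow> sim F' s s' \<longrightarrow> s \<in> Y \<longrightarrow> s' \<in> Y))"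

definition S :: "('i \<Rightarrow> 'i set) set set"
  where "S = {Y. Y \<subseteq> V \<and> invar Y}"

lemma sim_sym: "sim F s s' \<Longrightarrow> sim F s' s"
  by (auto simp: sim_def inj_on_def)

lemma invarE:
  assumes "invar Y"
  obtains F where "finite F" "\<And>F' s s'. \<lbrakk>finite F'; F \<subseteq> F'; s \<in> V; s' \<in> V; sim F' s s'\<rbrakk> \<Longrightarrow> s \<in> Y \<longleftrightarrow> s' \<in> Y"
  using assms sim_sym unfolding invar_def by metis

lemma invar_join: "\<lbrakk>invar Y; invar Z\<rbrakk> \<Longrightarrow> invar (Y \<union> Z)"
  by (elim invarE, unfold invar_def, rule_tac x = "F \<union> Fa" in exI) auto

lemma invar_compl: "invar Y \<Longrightarrow> invar (V - Y)"
  by (elim invarE, unfold invar_def, rule_tac x = F in exI) auto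

text \<open>A back-and-forth step. If \<open>u\<close> is a value of \<open>s\<close> at another
  coordinate, the matching value of \<open>s'\<close> is used, and the repetition makes colours
  invisible. If \<open>u\<close> is new, the colouring supplies a new value giving the same colour.
  Having \<open>i\<close> in \<open>F'\<close> exempts the changed coordinate from
  agreement.\<close>

lemma invar_cyl:
  assumes Y: "Y \<subseteq> V" "invar Y" and i: "i \<in> I"
  shows "invar (cyl \<A> i Y)"
proof -
  obtain F where F: "finite F" and
    inv: "\<And>F' s s'. \<lbrakk>finite F'; F \<subseteq> F'; s \<in> V; s' \<in> V; sim F' s s'\<rbrakk> \<Longrightarrow> s \<in> Y \<longleftrightarrow> s' \<in> Y"
    using invarE[OF Y(2)] by metis
  have "s' \<in> cyl \<A> i Y"
    if F': "finite F'" "insert i F \<subseteq> F'" and s: "s \<in> V" "s' \<in> V" "sim F' s s'" "s \<in> cyl \<A> i Y" for F' s s'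
  proof -
    obtain u where u: "s(i := u) \<in> Y"
      using s(4) Y(1) i by (auto simp: cyl_full)
    have ex: "\<exists>u'. sim F' (s(i := u)) (s'(i := u'))"
    proof (cases "\<exists>k\<in>I - {i}. u = s k")
      case True
      then obtain k where k: "k \<in> I" "k \<noteq> i" "u = s k"
        by auto
      then have "\<not> inj_on (s(i := u)) I"
        using i by (auto simp: inj_on_def)
      moreover have "\<forall>l\<in>I. \<forall>m\<in>I. (s(i := s k)) l = (s(i := s k)) m \<longleftrightarrow> (s'(i := s' k)) l = (s'(i := s' k)) m"
        using s(3) k by (simp add: sim_def)
      ultimately show ?thesis
        using s(3) k F'(2) by (intro exI[of _ "s' k"]) (auto simp: sim_def)
    next
      case False
      obtain u' where u': "X (s'(i := u')) = X (s(i := u))" "u' \<notin> range s'"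
        using X[of s' i "X (s(i := u))" s'] by (elim exE conjE) (rule that)
      then have "u' \<noteq> s' k" for k
        by auto
      then show ?thesis
        using s(3) False u'(1) F'(2) by (intro exI[of _ u']) (auto simp: sim_def)
    qed
    then obtain u' where "sim F' (s(i := u)) (s'(i := u'))"
      by blast
    then have "s'(i := u') \<in> Y"
      using inv[of F' "s(i := u)" "s'(i := u')"] F' u s(1,2) i by simp
    then show ?thesis
      using Y(1) i s(2) by (auto simp: cyl_full)
  qed
  then show ?thesis
    unfolding invar_def using F by (intro exI[of _ "insert i F"]) blast
qed

lemma invar_diag: "\<lbrakk>i \<in> I; j \<in> I\<rbrakk> \<Longrightarrow> invar (diag \<A> i j)"
  by (auto simp: invar_def sim_def)

definition cell :: "'i set \<Rightarrow> ('i \<Rightarrow> 'i set) set"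
  where "cell j = {s \<in> V. inj_on s I \<and> X s = j}"

lemma cell_in_S: "cell j \<in> S"
  by (auto simp: S_def cell_def invar_def sim_def inj_on_def)

lemma closed_S: "closed_under I \<A> S"
  unfolding closed_under_def
proof (intro conjI ballI)
  fix i Y assume "i \<in> I" "Y \<in> S"
  then show "cyl \<A> i Y \<in> S"
    using invar_cyl cyl_full_subset by (auto simp: S_def)
next
  fix i j assume "i \<in> I" "j \<in> I"
  then show "diag \<A> i j \<in> S"
    using invar_diag by (auto simp: S_def)
qed (use invar_join invar_compl in \<open>auto simp: S_def\<close>)

abbreviation \<S> :: "(('i \<Rightarrow> 'i set) set, 'i) cyl_structure"
  where "\<S> \<equiv> \<A>\<lparr>carrier := S\<rparr>"

lemma S_ne: "S \<noteq> {}"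
  using cell_in_S by auto

lemma S_in_RCA: "\<S> \<in> RCA TYPE('i set) I"
proof -
  have "\<S> \<in> Sub I {full_cyl_set_algebra (\<Union>\<U>) (\<Union>U\<in>\<U>. I \<rightarrow>\<^sub>E U) | \<U> :: 'i set set set.
      disjoint ((\<lambda>U. I \<rightarrow>\<^sub>E U) ` \<U>)}"
    unfolding Sub_def mem_Collect_eq
  proof (intro exI conjI)
    show "\<S> = \<A>\<lparr>carrier := S\<rparr>" ..
    show "\<A> = full_cyl_set_algebra (\<Union>{UNIV}) (\<Union>U\<in>{UNIV}. I \<rightarrow>\<^sub>E U)"
      by (simp add: V_def \<A>_def)
  qed (use disjoint_squares S_ne closed_S in \<open>auto simp: S_def\<close>)
  moreover have "cyl_iso I \<S> \<S>"
    using S_ne closed_S by (intro cyl_iso_refl) (simp add: cyl_type_algebra_def closed_under_def)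
  ultimately show ?thesis
    unfolding RCA_def Iso_def by blast
qed

lemma bot_S: "bot_el \<S> = {}"
proof -
  have "top_el \<S> = V"
    unfolding top_el_def using S_ne by (intro the_equality) (auto simp: S_def)
  then show ?thesis
    by (simp add: bot_el_def)
qed

text \<open>One new value at \<open>i\<close> both restores injectivity and produces any desired
  colour, which is why \<open>j\<close> leaves no trace.\<close>

lemma cyl_cell:
  assumes "i \<in> I"
  shows "cyl \<A> i (cell j) = {s \<in> V. inj_on s (I - {i})}"
proof -
  have "\<exists>u. inj_on (s(i := u)) I \<and> X (s(i := u)) = j" if "inj_on s (I - {i})" for s
  proof -
    obtain u where u: "X (s(i := u)) = j" "u \<notin> range s"
      using X[of s i j s] by (elim exE conjE) (rule that)
    then have "inj_on (s(i := u)) I"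
      using that by (auto simp: inj_on_def)
    then show ?thesis
      using u by blast
  qed
  moreover have "inj_on s (I - {i})" if "inj_on (s(i := u)) I" for s u
    using that by (auto simp: inj_on_def split: if_splits)
  moreover have "cell j \<subseteq> V"
    by (auto simp: cell_def)
  ultimately show ?thesis
    using assms by (auto simp: cyl_full cell_def)
qed

text \<open>
  The cells \<open>cell j\<close> are more than \<open>|I|\<close> disjoint elements with the same \<open>i0\<close>-cylindrification. If
  their images under \<open>h\<close> do not depend on \<open>\<kappa>\<close>, they contain sequences that are noninjective off
  \<open>i0\<close>, where at most one of the images can use a value at \<open>i0\<close> outside the range of the sequence.
\<close>

lemma S_not_Edc: "\<not> endo_dimension_complemented I \<S>"
proof
  assume edc: "endo_dimension_complemented I \<S>"
  obtain i0 where i0: "i0 \<in> I"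
    using infinite_index by fastforce
  define D where "D = {s \<in> V. inj_on s (I - {i0})}"
  have cD: "cyl \<A> i0 (cell j) = D" for j
    using cyl_cell[OF i0] by (simp add: D_def)
  then have DS: "D \<in> S"
    using closed_S cell_in_S i0 by (metis closed_under_def)
  have "restrict (\<lambda>k. {k}) I \<in> D"
    by (auto simp: D_def V_UNIV inj_on_def)
  then have "\<exists>\<kappa>\<in>I - {i0}. \<exists>h\<in>cyl_hom {i0} \<S> \<S>. h D \<noteq> \<zero>\<^bsub>\<S>\<^esub> \<and> (\<forall>a\<in>carrier \<S>. cyl \<S> \<kappa> (h a) = h a)"
    using edc[unfolded endo_dimension_complemented_def, rule_format, of "{i0}" D] i0 DS by (auto simp: bot_S)
  then obtain \<kappa> h where \<kappa>: "\<kappa> \<in> I" "\<kappa> \<noteq> i0" and h: "h \<in> cyl_hom {i0} \<S> \<S>" "h D \<noteq> {}"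
    and \<kappa>h: "\<And>a. a \<in> S \<Longrightarrow> cyl \<A> \<kappa> (h a) = h a"
    by (auto simp: bot_S)
  have hS: "h a \<in> S" "h a \<subseteq> V" if "a \<in> S" for a
    using h that by (auto simp: cyl_hom_def S_def)
  have h_cell: "cyl \<A> i0 (h (cell j)) = h D" for j
    using h(1) cell_in_S[of j] cD[of j] by (auto simp: cyl_hom_def)
  have SC: "V - a \<in> S" if "a \<in> S" for a
    using closed_S that by (auto simp: closed_under_def)
  have hC: "h (V - a) = V - h a" if "a \<in> S" for a
    using h(1) that by (auto simp: cyl_hom_def)
  have hU: "h (a \<union> b) = h a \<union> h b" if "a \<in> S" "b \<in> S" for a b
    using h(1) that by (auto simp: cyl_hom_def)
  have h_disj: "h (cell j) \<inter> h (cell k) = {}" if "j \<noteq> k" for j k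
  proof -
    have "(V - cell j) \<union> (V - cell k) = V"
      using that by (auto simp: cell_def)
    moreover have "h ((V - cell j) \<union> (V - cell k)) = (V - h (cell j)) \<union> (V - h (cell k))"
      using hU[OF SC[OF cell_in_S] SC[OF cell_in_S]] hC[OF cell_in_S] by metis
    moreover have "h V = V"
    proof -
      have "h (cell j \<union> (V - cell j)) = h (cell j) \<union> (V - h (cell j))"
        using hU[OF cell_in_S SC[OF cell_in_S]] hC[OF cell_in_S] by metis
      moreover have "cell j \<union> (V - cell j) = V"
        by (auto simp: cell_def)
      ultimately show ?thesis
        using hS(2)[OF cell_in_S] by auto
    qed
    ultimately have "(V - h (cell j)) \<union> (V - h (cell k)) = V"
      by metis
    then show ?thesis
      using hS(2)[OF cell_in_S] by blast
  qed
  obtain i1 where i1: "i1 \<in> I" "i1 \<noteq> i0" "i1 \<noteq> \<kappa>"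
    using infinite_index by (metis finite.emptyI finite_insert finite_subset insertCI subsetI)
  obtain s' where s': "s' \<in> h D"
    using h(2) by blast
  \<comment> \<open>Repeating the value of \<open>i1\<close> at \<kappa> destroys injectivity off
    \<open>i0\<close>, while the sequence stays in \<open>h D\<close>, which does not depend on
    \<kappa>.\<close>
  define s where "s = s'(\<kappa> := s' i1)"
  have "s(\<kappa> := s' \<kappa>) \<in> h D" "s \<in> V"
    using s' hS(2)[OF DS] \<kappa>(1) by (auto simp: s_def)
  then have "s \<in> cyl \<A> \<kappa> (h D)"
    using hS(2)[OF DS] \<kappa>(1) by (auto simp: cyl_full)
  then have s: "s \<in> h D" "s \<in> V" "s \<kappa> = s i1"
    using \<kappa>h[OF DS] \<open>s \<in> V\<close> i1 by (auto simp: s_def)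
  have "\<exists>u. s(i0 := u) \<in> h (cell j)" for j
    using s(1) i0 hS(2)[OF cell_in_S] unfolding h_cell[of j, symmetric] by (auto simp: cyl_full)
  then obtain u where u: "\<And>j. s(i0 := u j) \<in> h (cell j)"
    by metis
  have u_inj: "j = k" if "u j = u k" for j k
    using u[of j] u[of k] h_disj[of j k] that by auto
  have not_inj: "\<not> inj_on (s(i0 := w)) I" for w
    using s(3) \<kappa> i1 by (auto simp: inj_on_def)
  \<comment> \<open>Two new values at \<open>i0\<close> give the same equality pattern on
    noninjective sequences, where colours do not count; invariance would put one sequence into two
    disjoint images.\<close>
  have unique: "j = k" if jk: "u j \<notin> s ` (I - {i0})" "u k \<notin> s ` (I - {i0})" for j k
  proof (rule ccontr)
    assume "j \<noteq> k"
    obtain F where F: "finite F" and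
      inv: "\<And>F' s s'. \<lbrakk>finite F'; F \<subseteq> F'; s \<in> V; s' \<in> V; sim F' s s'\<rbrakk> \<Longrightarrow> s \<in> h (cell j) \<longleftrightarrow> s' \<in> h (cell j)"
      using invarE[of "h (cell j)"] hS(1)[OF cell_in_S] by (metis (no_types, lifting) S_def mem_Collect_eq)
    have "u j \<noteq> s l" "u k \<noteq> s l" if "l \<in> I" "l \<noteq> i0" for l
      using jk that by auto
    then have "sim (insert i0 F) (s(i0 := u j)) (s(i0 := u k))"
      using not_inj by (auto simp: sim_def)
    then have "s(i0 := u k) \<in> h (cell j)"
      using inv[of "insert i0 F" "s(i0 := u j)" "s(i0 := u k)"] F s(2) i0 u[of j] by auto
    then show False
      using u[of k] h_disj[OF \<open>j \<noteq> k\<close>] by auto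
  qed
  define j0 where "j0 = (SOME j. u j \<notin> s ` (I - {i0}))"
  \<comment> \<open>Every colour is reached: \<open>i0\<close> yields the only colour whose value is
    new, if there is one, and another index \<open>i\<close> the colour whose value is
    \<open>s i\<close>, if any. So the index type is mapped onto its power set.\<close>
  define \<phi> where "\<phi> i = (if i = i0 then j0 else (SOME j. u j = s i))" for i
  have "j \<in> range \<phi>" for j
  proof (cases "u j \<in> s ` (I - {i0})")
    case True
    then obtain i where "i \<noteq> i0" "u j = s i"
      by auto
    then have "u (\<phi> i) = u j"
      using someI[of "\<lambda>k. u k = s i" j] by (simp add: \<phi>_def)
    then show ?thesis
      using u_inj by blast
  next
    case False
    then have "u j0 \<notin> s ` (I - {i0})"
      unfolding j0_def by (rule someI)
    then have "\<phi> i0 = j"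
      using unique False by (simp add: \<phi>_def)
    then show ?thesis
      by blast
  qed
  then have "\<phi> ` UNIV = Pow UNIV"
    by auto
  then show False
    using Cantors_theorem[of "UNIV :: 'i set"] by blast
qed

end

lemma RCA_not_subset_Edc:
  assumes "infinite (I :: 'i set)"
  shows "\<exists>A :: (('i \<Rightarrow> 'i set) set, 'i) cyl_structure. A \<in> RCA TYPE('i set) I \<and> A \<notin> Edc I"
proof -
  have "infinite (UNIV :: 'i set)"
    using assms finite_subset[OF subset_UNIV] by auto
  from ex_balanced_colouring[OF this] obtain X :: "('i \<Rightarrow> 'i set) \<Rightarrow> 'i set"
    where X: "\<forall>t i j (f :: 'i \<Rightarrow> 'i set). \<exists>u. X (t(i := u)) = j \<and> u \<notin> range f" ..
  interpret colouring I X
    using assms X by unfold_locales auto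
  show ?thesis
    using S_in_RCA S_not_Edc by (auto simp: Edc_def)
qed

section \<open>Limits of truth valuations\<close>

text \<open>
  Compactness of \<open>{0,1}\<^sup>T\<close>: a filter base of sets of valuations has a cluster point.
\<close>

lemma ex_cluster_valuation:
  fixes S :: "'k set \<Rightarrow> ('t \<Rightarrow> bool) set"
  assumes ne: "\<And>D. finite D \<Longrightarrow> S D \<noteq> {}" and anti: "\<And>D D'. D \<subseteq> D' \<Longrightarrow> S D' \<subseteq> S D"
  shows "\<exists>v. \<forall>D F. finite D \<longrightarrow> finite F \<longrightarrow> (\<exists>f\<in>S D. \<forall>t\<in>F. f t = v t)"
proof -
  \<comment> \<open>Partial assignments, as sets of pairs, all of whose finite parts are realised in
    every \<open>S D\<close> with \<open>D\<close> finite. A maximal one is taken by Zorn's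
    lemma.\<close>
  define good where "good M \<longleftrightarrow> (\<forall>D F. finite D \<longrightarrow> finite F \<longrightarrow> F \<subseteq> M \<longrightarrow> (\<exists>f\<in>S D. \<forall>q\<in>F. f (fst q) = snd q))"
    for M :: "('t \<times> bool) set"
  have "\<exists>M\<in>Collect good. \<forall>X\<in>Collect good. M \<subseteq> X \<longrightarrow> X = M"
  proof (rule subset_Zorn_nonempty)
    have "good {}"
      using ne by (fastforce simp: good_def)
    then show "Collect good \<noteq> {}"
      by blast
  next
    fix \<C> assume \<C>: "\<C> \<noteq> {}" "subset.chain (Collect good) \<C>"
    have "\<exists>f\<in>S D. \<forall>q\<in>F. f (fst q) = snd q" if D: "finite D" and F: "finite F" "F \<subseteq> \<Union>\<C>" for D F
    proof -
      obtain M where "M \<in> \<C>" "F \<subseteq> M"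
        using finite_subset_Union_chain[OF F \<C>] by blast
      moreover have "good M"
        using \<open>M \<in> \<C>\<close> \<C>(2) by (auto simp: subset.chain_def)
      ultimately show ?thesis
        using D F by (auto simp: good_def)
    qed
    then show "\<Union>\<C> \<in> Collect good"
      by (simp add: good_def)
  qed
  then obtain M where M: "good M" and max: "\<And>X. good X \<Longrightarrow> M \<subseteq> X \<Longrightarrow> X = M"
    by auto
  have dec: "(t, True) \<in> M \<or> (t, False) \<in> M" for t
  proof (rule ccontr)
    assume neg: "\<not> ?thesis"
    have "\<not> good (insert (t, b) M)" for b
      using neg max[of "insert (t, b) M"] by (cases b) auto
    then have "\<exists>D F. finite D \<and> finite F \<and> F \<subseteq> insert (t, b) M \<and> \<not> (\<exists>f\<in>S D. \<forall>q\<in>F. f (fst q) = snd q)" for b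
      unfolding good_def not_all not_imp .
    then obtain D F where DF: "\<And>b. finite (D b)" "\<And>b. finite (F b)" "\<And>b. F b \<subseteq> insert (t, b) M"
      and no: "\<And>b f. f \<in> S (D b) \<Longrightarrow> \<exists>q\<in>F b. f (fst q) \<noteq> snd q"
      by metis
    \<comment> \<open>Both failures are refuted together: a valuation meeting the joint requirements
      has some value at \<open>t\<close>, and this contradicts the failure recorded for that
      value.\<close>
    have "\<exists>f\<in>S (D True \<union> D False). \<forall>q\<in>(F True \<union> F False) \<inter> M. f (fst q) = snd q"
      using M[unfolded good_def, rule_format, of "D True \<union> D False" "(F True \<union> F False) \<inter> M"] DF(1,2) by simp
    then obtain f where f: "f \<in> S (D True \<union> D False)" "\<forall>q\<in>(F True \<union> F False) \<inter> M. f (fst q) = snd q"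
      by blast
    have "f \<in> S (D (f t))"
      using f(1) anti[of "D (f t)" "D True \<union> D False"] by (cases "f t") auto
    from no[OF this] obtain q where q: "q \<in> F (f t)" "f (fst q) \<noteq> snd q"
      by blast
    then have "q \<in> F True \<union> F False"
      by (cases "f t") auto
    then show False
      using q f(2) DF(3)[of "f t"] by auto
  qed
  have "\<exists>f\<in>S D. \<forall>t\<in>F. f t = ((t, True) \<in> M)" if "finite D" "finite F" for D F
  proof -
    let ?F = "(\<lambda>t. (t, (t, True) \<in> M)) ` F"
    have "(t, (t, True) \<in> M) \<in> M" for t
      using dec[of t] by (cases "(t, True) \<in> M") auto
    then have "?F \<subseteq> M"
      by blast
    then have "\<exists>f\<in>S D. \<forall>q\<in>?F. f (fst q) = snd q"
      using M[unfolded good_def, rule_format, of D ?F] that by simp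
    then show ?thesis
      by auto
  qed
  then show ?thesis
    by (intro exI[of _ "\<lambda>t. (t, True) \<in> M"]) auto
qed

section \<open>Points of a Boolean algebra\<close>

context boolean_algebra_on
begin

lemma meet_closed: "\<lbrakk>x \<in> carrier A; y \<in> carrier A\<rbrakk> \<Longrightarrow> x \<odot> y \<in> carrier A"
  by (simp add: meet_def join_closed compl_closed)

lemma top_closed: "\<one> \<in> carrier A"
  using nonempty join_compl join_closed compl_closed by (metis ex_in_conv)

lemma bot_closed: "\<zero> \<in> carrier A"
  by (simp add: bot_el_def compl_closed top_closed)

lemmas closed [simp] = join_closed compl_closed meet_closed top_closed bot_closed

text \<open>Ultrafilters as characteristic functions; through them Boolean identities reduce to
  propositional logic.\<close>

definition point :: "('a \<Rightarrow> bool) \<Rightarrow> bool"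
  where "point p \<longleftrightarrow> (\<forall>x\<in>carrier A. \<forall>y\<in>carrier A. p (x \<oplus> y) \<longleftrightarrow> p x \<or> p y) \<and>
    (\<forall>x\<in>carrier A. p (\<sim> x) \<longleftrightarrow> \<not> p x)"

lemma point_join [simp]: "\<lbrakk>point p; x \<in> carrier A; y \<in> carrier A\<rbrakk> \<Longrightarrow> p (x \<oplus> y) \<longleftrightarrow> p x \<or> p y"
  and point_compl [simp]: "\<lbrakk>point p; x \<in> carrier A\<rbrakk> \<Longrightarrow> p (\<sim> x) \<longleftrightarrow> \<not> p x"
  by (auto simp: point_def)

lemma point_meet [simp]: "\<lbrakk>point p; x \<in> carrier A; y \<in> carrier A\<rbrakk> \<Longrightarrow> p (x \<odot> y) \<longleftrightarrow> p x \<and> p y"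
  by (simp add: meet_def)

lemma point_top [simp]: "point p \<Longrightarrow> p \<one>"
  using nonempty join_compl by (metis ex_in_conv point_compl point_join compl_closed)

lemma point_bot [simp]: "point p \<Longrightarrow> \<not> p \<zero>"
  by (simp add: bot_el_def)

lemma join_idem: "x \<in> carrier A \<Longrightarrow> x \<oplus> x = x"
  by (metis join_absorb meet_absorb join_closed)

lemma meet_idem: "x \<in> carrier A \<Longrightarrow> x \<odot> x = x"
  by (metis join_absorb meet_absorb meet_closed)

lemma meet_top: "x \<in> carrier A \<Longrightarrow> x \<odot> \<one> = x"
  by (metis join_compl meet_absorb compl_closed)

lemma meet_bot: "x \<in> carrier A \<Longrightarrow> x \<odot> \<zero> = \<zero>"
  by (metis meet_compl meet_assoc meet_idem compl_closed)

text \<open>Below \<open>x\<close> some nonzero element decides any given finite set, because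
  \<open>e\<close> is the join of \<open>e \<odot> b\<close> and \<open>e \<odot> \<sim> b\<close>,
  not both zero. The ultrafilter is a cluster point of the valuations sending \<open>b\<close> to
  the truth value of \<open>e \<odot> b = e\<close>.\<close>

lemma ex_point:
  assumes x: "x \<in> carrier A" "x \<noteq> \<zero>"
  shows "\<exists>p. point p \<and> p x"
proof -
  define dec where "dec D e \<longleftrightarrow> e \<in> carrier A \<and> e \<noteq> \<zero> \<and> e \<odot> x = e \<and>
    (\<forall>b\<in>D \<inter> carrier A. e \<odot> b = e \<or> e \<odot> \<sim> b = e)" for D e
  define S where "S D = {f. \<exists>e. dec D e \<and> f = (\<lambda>b. e \<odot> b = e)}" for D
  have "\<exists>e. dec D e" if "finite D" for D
    using that
  proof induction
    case empty
    show ?case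
      using x by (intro exI[of _ x]) (simp add: dec_def meet_idem)
  next
    case (insert b D)
    then obtain e where e: "dec D e"
      by blast
    show ?case
    proof (cases "b \<in> carrier A")
      case True
      have eC: "e \<in> carrier A"
        using e by (simp add: dec_def)
      have pres: "(e \<odot> b') \<odot> c = e \<odot> b'" if "e \<odot> c = e" "b' \<in> carrier A" "c \<in> carrier A" for b' c
        using that eC by (metis meet_assoc meet_comm)
      have self: "(e \<odot> b') \<odot> b' = e \<odot> b'" if "b' \<in> carrier A" for b'
        using that eC by (metis meet_assoc meet_idem)
      have *: "dec (insert b D) (e \<odot> b')" if "b' = b \<or> b' = \<sim> b" "e \<odot> b' \<noteq> \<zero>" for b'
      proof -
        have b': "b' \<in> carrier A"
          using that True by auto
        have "(e \<odot> b') \<odot> c = e \<odot> b' \<or> (e \<odot> b') \<odot> \<sim> c = e \<odot> b'" if c: "c \<in> insert b D \<inter> carrier A" for c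
        proof (cases "c = b")
          case True
          then show ?thesis
            using \<open>b' = b \<or> b' = \<sim> b\<close> self[OF b'] by auto
        next
          case False
          then have "e \<odot> c = e \<or> e \<odot> \<sim> c = e"
            using c e by (auto simp: dec_def)
          then show ?thesis
            using pres[OF _ b'] c by auto
        qed
        moreover have "(e \<odot> b') \<odot> x = e \<odot> b'"
          using pres[OF _ b' x(1)] e by (simp add: dec_def)
        ultimately show ?thesis
          using that(2) eC b' by (simp add: dec_def)
      qed
      have "(e \<odot> b) \<oplus> (e \<odot> \<sim> b) = e"
        using meet_distrib[of e b "\<sim> b"] eC True by (simp add: join_compl meet_top)
      moreover have "e \<noteq> \<zero>"
        using e by (simp add: dec_def)
      ultimately have "e \<odot> b \<noteq> \<zero> \<or> e \<odot> \<sim> b \<noteq> \<zero>"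
        using join_idem[OF bot_closed] by auto
      then show ?thesis
        using * by blast
    next
      case False
      then show ?thesis
        using e by (intro exI[of _ e]) (simp add: dec_def)
    qed
  qed
  then have ne: "S D \<noteq> {}" if "finite D" for D
    using that by (auto simp: S_def)
  have anti: "S D' \<subseteq> S D" if "D \<subseteq> D'" for D D'
    using that by (auto simp: S_def dec_def)
  obtain v where v: "\<And>D F. \<lbrakk>finite D; finite F\<rbrakk> \<Longrightarrow> \<exists>f\<in>S D. \<forall>t\<in>F. f t = v t"
    using ex_cluster_valuation[of S, OF ne anti] by blast
  have obt: "\<exists>e. dec F e \<and> (\<forall>b\<in>F. v b \<longleftrightarrow> e \<odot> b = e)" if "finite F" for F
    using v[OF that that] by (auto simp: S_def)
  have sep: "\<not> (e \<odot> b = e \<and> e \<odot> \<sim> b = e)" if "dec F e" "b \<in> carrier A" for F e b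
    using that meet_bot meet_compl meet_assoc compl_closed unfolding dec_def by metis
  have v_x: "v x"
    using obt[of "{x}"] by (auto simp: dec_def)
  have v_compl: "v (\<sim> b) \<longleftrightarrow> \<not> v b" if b: "b \<in> carrier A" for b
  proof -
    obtain e where e: "dec {b, \<sim> b} e" "\<forall>c\<in>{b, \<sim> b}. v c \<longleftrightarrow> e \<odot> c = e"
      using obt[of "{b, \<sim> b}"] by auto
    then show ?thesis
      using sep[OF e(1) b] b by (auto simp: dec_def)
  qed
  have "v (b \<oplus> c) \<longleftrightarrow> v b \<or> v c" if bc: "b \<in> carrier A" "c \<in> carrier A" for b c
  proof -
    obtain e where e: "dec {b, c, b \<oplus> c} e" "\<forall>d\<in>{b, c, b \<oplus> c}. v d \<longleftrightarrow> e \<odot> d = e"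
      using obt[of "{b, c, b \<oplus> c}"] by auto
    have eC: "e \<in> carrier A" "e \<noteq> \<zero>"
      using e(1) by (auto simp: dec_def)
    have d: "e \<odot> (b \<oplus> c) = (e \<odot> b) \<oplus> (e \<odot> c)"
      using meet_distrib eC bc by simp
    have zero: "e \<odot> d = \<zero>" if "e \<odot> \<sim> d = e" "d \<in> carrier A" for d
    proof -
      have "e \<odot> d = e \<odot> (\<sim> d \<odot> d)"
        using that eC meet_assoc compl_closed by metis
      then show ?thesis
        using that eC meet_comm[of "\<sim> d" d] by (simp add: meet_compl meet_bot)
    qed
    show ?thesis
    proof
      assume "v (b \<oplus> c)"
      then have "e \<odot> (b \<oplus> c) = e"
        using e by auto
      then show "v b \<or> v c"
        using e bc zero d eC join_idem[OF bot_closed] unfolding dec_def by fastforce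
    next
      assume "v b \<or> v c"
      then have "e \<odot> b = e \<or> e \<odot> c = e"
        using e by auto
      then have "e \<odot> (b \<oplus> c) = e"
        using d join_absorb[of e b] join_absorb[of e c] join_comm[of e "e \<odot> b"] eC bc by auto
      then show "v (b \<oplus> c)"
        using e by auto
    qed
  qed
  then have "point v"
    unfolding point_def using v_compl by (intro conjI ballI)
  then show ?thesis
    using v_x by blast
qed

lemma eq_by_points:
  assumes xy: "x \<in> carrier A" "y \<in> carrier A" and "\<And>p. point p \<Longrightarrow> p x \<longleftrightarrow> p y"
  shows "x = y"
proof -
  have z: "u \<odot> \<sim> w = \<zero>" if "\<And>p. point p \<Longrightarrow> p u \<longleftrightarrow> p w" "u \<in> carrier A" "w \<in> carrier A" for u w
    using ex_point[of "u \<odot> \<sim> w"] that by (metis compl_closed meet_closed point_compl point_meet)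
  have "u = (u \<odot> w) \<oplus> (u \<odot> \<sim> w)" if "u \<in> carrier A" "w \<in> carrier A" for u w
    using meet_distrib[of u w "\<sim> w"] that by (simp add: join_compl meet_top)
  then show ?thesis
    using z[of x y] z[of y x] assms meet_comm[of x y] by metis
qed

lemma eq_bot_by_points: "\<lbrakk>x \<in> carrier A; \<And>p. point p \<Longrightarrow> \<not> p x\<rbrakk> \<Longrightarrow> x = \<zero>"
  using ex_point by blast

end

section \<open>Substitutions in cylindric algebras\<close>

context cylindric_algebra
begin

lemmas [simp] = cyl_closed diag_closed

lemma cyl_le: "\<lbrakk>point p; i \<in> \<alpha>; x \<in> carrier A; p x\<rbrakk> \<Longrightarrow> p (cyl A i x)"
  using cyl_increasing[of i x] point_join[of p x "cyl A i x"] by (simp add: below_def)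

lemma cyl_mono:
  assumes "\<And>q. point q \<Longrightarrow> q x \<Longrightarrow> q y" "i \<in> \<alpha>" "x \<in> carrier A" "y \<in> carrier A" "point p" "p (cyl A i x)"
  shows "p (cyl A i y)"
proof -
  have "x \<oplus> y = y"
    by (rule eq_by_points) (use assms(1-4) in auto)
  then show ?thesis
    using cyl_join[of i x y] assms(2-) by (metis cyl_closed point_join)
qed

lemma cyl_top [simp]: "i \<in> \<alpha> \<Longrightarrow> cyl A i \<one> = \<one>"
  by (rule eq_by_points) (auto intro: cyl_le)

lemma cyl_bot [simp]: "i \<in> \<alpha> \<Longrightarrow> cyl A i \<zero> = \<zero>"
  using cyl_compl[of i "\<one>"] by (simp add: bot_el_def)

lemma cyl_meet_cyl:
  assumes "i \<in> \<alpha>" "x \<in> carrier A" "y \<in> carrier A"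
  shows "cyl A i (x \<odot> cyl A i y) = cyl A i x \<odot> cyl A i y"
proof (rule eq_by_points)
  fix p assume p: "point p"
  have "p (cyl A i y)" if "p (cyl A i (x \<odot> cyl A i y))"
    using cyl_mono[of "x \<odot> cyl A i y" "cyl A i y" i p] that assms p by (auto simp flip: cyl_idem)
  moreover have "p (cyl A i x)" if "p (cyl A i (x \<odot> cyl A i y))"
    using cyl_mono[of "x \<odot> cyl A i y" x i p] that assms p by auto
  moreover have "p (cyl A i (x \<odot> cyl A i y))" if "p (cyl A i x)" "p (cyl A i y)"
  proof -
    \<comment> \<open>The join lies above \<open>x\<close>, and its last summand is fixed by the
      cylindrification.\<close>
    have "p (cyl A i ((x \<odot> cyl A i y) \<oplus> \<sim> cyl A i y))"
      by (rule cyl_mono[of x]) (use that assms p in auto)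
    then show ?thesis
      using assms p that by (simp add: cyl_join cyl_compl)
  qed
  ultimately show "p (cyl A i (x \<odot> cyl A i y)) \<longleftrightarrow> p (cyl A i x \<odot> cyl A i y)"
    using assms p by auto
qed (use assms in auto)

text \<open>In the usual terms: \<open>i\<close> is outside the dimension set of
  \<open>x\<close>.\<close>

definition cfix :: "'i \<Rightarrow> 'a \<Rightarrow> bool"
  where "cfix i x \<longleftrightarrow> cyl A i x = x"

lemma cfix_cyl: "\<lbrakk>i \<in> \<alpha>; x \<in> carrier A\<rbrakk> \<Longrightarrow> cfix i (cyl A i x)"
  by (simp add: cfix_def flip: cyl_idem)

lemma cyl_meet_cfix: "\<lbrakk>i \<in> \<alpha>; x \<in> carrier A; y \<in> carrier A; cfix i y\<rbrakk> \<Longrightarrow> cyl A i (x \<odot> y) = cyl A i x \<odot> y"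
  using cyl_meet_cyl[of i x y] by (simp add: cfix_def)

lemma cfix_join: "\<lbrakk>i \<in> \<alpha>; x \<in> carrier A; y \<in> carrier A; cfix i x; cfix i y\<rbrakk> \<Longrightarrow> cfix i (x \<oplus> y)"
  by (simp add: cfix_def cyl_join)

lemma cfix_compl: "\<lbrakk>i \<in> \<alpha>; x \<in> carrier A; cfix i x\<rbrakk> \<Longrightarrow> cfix i (\<sim> x)"
  using cyl_compl[of i x] by (simp add: cfix_def)

lemma cfix_meet: "\<lbrakk>i \<in> \<alpha>; x \<in> carrier A; y \<in> carrier A; cfix i x; cfix i y\<rbrakk> \<Longrightarrow> cfix i (x \<odot> y)"
  by (simp add: meet_def cfix_join cfix_compl)

lemma cfix_cyl_other: "\<lbrakk>i \<in> \<alpha>; j \<in> \<alpha>; x \<in> carrier A; cfix j x\<rbrakk> \<Longrightarrow> cfix j (cyl A i x)"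
  using cyl_commute[of j i x] cfix_cyl by (cases "i = j") (auto simp: cfix_def)

lemma cfix_diag:
  assumes "i \<in> \<alpha>" "j \<in> \<alpha>" "k \<in> \<alpha>" "k \<noteq> i" "k \<noteq> j"
  shows "cfix k (diag A i j)"
proof (cases "i = j")
  case True
  then show ?thesis
    using assms by (simp add: diag_refl cfix_def)
next
  case False
  then show ?thesis
    using assms diag_trans[of i k j] cfix_cyl[of k "diag A i k \<odot> diag A k j"] by simp
qed

lemma diag_commute: "\<lbrakk>i \<in> \<alpha>; j \<in> \<alpha>\<rbrakk> \<Longrightarrow> diag A i j = diag A j i"
  using diag_sym by (cases "i = j") auto

lemma diag_trans_le:
  assumes "point p" "i \<in> \<alpha>" "j \<in> \<alpha>" "k \<in> \<alpha>" "p (diag A i j)" "p (diag A j k)"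
  shows "p (diag A i k)"
proof (cases "i = j \<or> j = k \<or> i = k")
  case True
  then show ?thesis
    using assms by (auto simp: diag_refl)
next
  case False
  then show ?thesis
    using diag_trans[of i j k] cyl_le[of p j "diag A i j \<odot> diag A j k"] assms by auto
qed

text \<open>The substitution operator of cylindric algebra theory, putting \<open>w\<close> for
  coordinate \<open>i\<close>. For \<open>w = i\<close> it degenerates to cylindrification, hence
  the side conditions below.\<close>

definition sub :: "'i \<Rightarrow> 'i \<Rightarrow> 'a \<Rightarrow> 'a"
  where "sub i w x = cyl A i (diag A i w \<odot> x)"

lemma sub_closed [simp]: "\<lbrakk>i \<in> \<alpha>; w \<in> \<alpha>; x \<in> carrier A\<rbrakk> \<Longrightarrow> sub i w x \<in> carrier A"
  by (simp add: sub_def)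

lemma sub_join:
  assumes "i \<in> \<alpha>" "w \<in> \<alpha>" "x \<in> carrier A" "y \<in> carrier A"
  shows "sub i w (x \<oplus> y) = sub i w x \<oplus> sub i w y"
  using assms by (simp add: sub_def meet_distrib cyl_join)

lemma sub_cyl:
  assumes "i \<in> \<alpha>" "w \<in> \<alpha>" "w \<noteq> i" "x \<in> carrier A" "cfix i x"
  shows "sub i w x = x"
proof -
  have "sub i w x = \<one> \<odot> x"
    using assms cyl_diag[of i w] by (simp add: sub_def cyl_meet_cfix)
  then show ?thesis
    using assms meet_comm[of "\<one>" x] by (simp add: meet_top)
qed

text \<open>The two values cover the unit because \<open>cyl A i (diag A i w) = \<one>\<close>. They
  are disjoint because, on the diagonal, \<open>diag_cyl\<close> cuts the cylindrification of
  \<open>diag A i w \<odot> \<sim> x\<close> back to the complement of \<open>x\<close>.\<close>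

lemma sub_compl:
  assumes iw: "i \<in> \<alpha>" "w \<in> \<alpha>" "w \<noteq> i" and x: "x \<in> carrier A"
  shows "sub i w (\<sim> x) = \<sim> sub i w x"
proof (rule eq_by_points)
  fix p assume p: "point p"
  let ?d = "diag A i w"
  have "sub i w (x \<oplus> \<sim> x) = \<one>"
    using iw x sub_cyl[of i w "\<one>"] by (simp add: join_compl cfix_def)
  then have "p (sub i w x) \<or> p (sub i w (\<sim> x))"
    using p iw x sub_join[of i w x "\<sim> x"] by (metis compl_closed point_join point_top sub_closed)
  moreover have "cyl A i ((?d \<odot> x) \<odot> cyl A i (?d \<odot> \<sim> x)) = \<zero>"
  proof -
    have "?d \<odot> cyl A i (?d \<odot> \<sim> x) = ?d \<odot> \<sim> x"
      using diag_cyl iw x by simp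
    then have "(?d \<odot> x) \<odot> cyl A i (?d \<odot> \<sim> x) = x \<odot> (?d \<odot> \<sim> x)"
      using iw x meet_comm[of ?d x] by (simp add: meet_assoc)
    moreover have "x \<odot> (?d \<odot> \<sim> x) = \<zero>"
      by (rule eq_bot_by_points) (use iw x in auto)
    ultimately have "(?d \<odot> x) \<odot> cyl A i (?d \<odot> \<sim> x) = \<zero>"
      by simp
    then show ?thesis
      using iw by simp
  qed
  then have "sub i w x \<odot> sub i w (\<sim> x) = \<zero>"
    using cyl_meet_cyl[of i "?d \<odot> x" "?d \<odot> \<sim> x"] iw x by (simp add: sub_def)
  then have "\<not> (p (sub i w x) \<and> p (sub i w (\<sim> x)))"
    using p iw x by (metis compl_closed point_bot point_meet sub_closed)
  ultimately show "p (sub i w (\<sim> x)) \<longleftrightarrow> p (\<sim> sub i w x)"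
    using p iw x by auto
qed (use assms in auto)

lemma sub_le_cyl: "\<lbrakk>point p; i \<in> \<alpha>; w \<in> \<alpha>; x \<in> carrier A; p (sub i w x)\<rbrakk> \<Longrightarrow> p (cyl A i x)"
  unfolding sub_def by (rule cyl_mono[of "diag A i w \<odot> x"]) auto

lemma sub_cyl_other:
  assumes "i \<in> \<alpha>" "w \<in> \<alpha>" "j \<in> \<alpha>" "j \<noteq> i" "j \<noteq> w" "x \<in> carrier A"
  shows "sub i w (cyl A j x) = cyl A j (sub i w x)"
proof -
  have "cfix j (diag A i w)"
    using assms by (simp add: cfix_diag)
  then have "cyl A j (diag A i w \<odot> x) = diag A i w \<odot> cyl A j x"
    using assms cyl_meet_cfix[of j x "diag A i w"] by (simp add: meet_comm)
  then show ?thesis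
    using assms by (simp add: sub_def cyl_commute[of j i])
qed

lemma cfix_sub:
  assumes "i \<in> \<alpha>" "w \<in> \<alpha>" "j \<in> \<alpha>" "j \<noteq> w" "x \<in> carrier A" "cfix j x"
  shows "cfix j (sub i w x)"
  using assms sub_cyl_other[of i w j x] cfix_cyl[of i "diag A i w \<odot> x"]
  by (cases "j = i") (auto simp: sub_def cfix_def)

lemma sub_diag:
  assumes "i \<in> \<alpha>" "j \<in> \<alpha>" "w \<in> \<alpha>" "i \<noteq> j" "i \<noteq> w"
  shows "sub i w (diag A i j) = diag A w j"
proof (cases "w = j")
  case True
  then show ?thesis
    using assms cyl_diag[of i j] by (simp add: sub_def meet_idem diag_refl)
next
  case False
  then show ?thesis
    using assms diag_trans[of w i j] diag_commute[of i w] by (simp add: sub_def)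
qed

text \<open>Renaming a bound variable.\<close>

lemma cyl_sub_fresh:
  assumes "i \<in> \<alpha>" "k \<in> \<alpha>" "k \<noteq> i" "x \<in> carrier A" "cfix k x"
  shows "cyl A k (sub i k x) = cyl A i x"
proof -
  have "cyl A k (diag A i k \<odot> x) = \<one> \<odot> x"
    using assms cyl_diag[of k i] diag_commute[of i k] by (simp add: cyl_meet_cfix)
  also have "\<dots> = x"
    using assms meet_comm[of "\<one>" x] by (simp add: meet_top)
  finally show ?thesis
    using assms cyl_commute[of k i "diag A i k \<odot> x"] by (simp add: sub_def)
qed

text \<open>\<open>diag A w w'\<close> does not depend on \<open>i\<close>, so it moves under the
  cylindrification, where transitivity of the diagonals replaces \<open>w\<close> by
  \<open>w'\<close>.\<close>

lemma sub_diag_le: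
  assumes p: "point p" and iw: "i \<in> \<alpha>" "w \<in> \<alpha>" "w' \<in> \<alpha>" "i \<noteq> w" "i \<noteq> w'" and x: "x \<in> carrier A"
    and "p (diag A w w')" "p (sub i w x)"
  shows "p (sub i w' x)"
proof -
  have "cfix i (diag A w w')"
    using iw by (simp add: cfix_diag)
  then have "p (cyl A i ((diag A i w \<odot> x) \<odot> diag A w w'))"
    using assms by (simp add: cyl_meet_cfix sub_def)
  then show ?thesis
    unfolding sub_def
    by (rule cyl_mono[rotated 5]) (use iw p x diag_trans_le[of _ i w w'] in auto)
qed

lemma sub_commute_aux:
  assumes "i \<in> \<alpha>" "j \<in> \<alpha>" "w \<in> \<alpha>" "w' \<in> \<alpha>" "i \<noteq> j" "j \<noteq> w" "x \<in> carrier A"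
  shows "sub i w (sub j w' x) = cyl A i (cyl A j (diag A i w \<odot> (diag A j w' \<odot> x)))"
proof -
  have "cfix j (diag A i w)"
    using assms by (simp add: cfix_diag)
  then have "cyl A j (diag A i w \<odot> (diag A j w' \<odot> x)) = diag A i w \<odot> cyl A j (diag A j w' \<odot> x)"
    using assms cyl_meet_cfix[of j "diag A j w' \<odot> x" "diag A i w"] meet_comm[of "diag A i w"] by simp
  then show ?thesis
    by (simp add: sub_def)
qed

lemma sub_commute:
  assumes "i \<in> \<alpha>" "j \<in> \<alpha>" "w \<in> \<alpha>" "w' \<in> \<alpha>" "i \<noteq> j" "j \<noteq> w" "i \<noteq> w'" "x \<in> carrier A"
  shows "sub i w (sub j w' x) = sub j w' (sub i w x)"
proof -
  have "diag A i w \<odot> (diag A j w' \<odot> x) = diag A j w' \<odot> (diag A i w \<odot> x)"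
    by (rule eq_by_points) (use assms in auto)
  then show ?thesis
    using assms by (simp add: sub_commute_aux cyl_commute[of i j])
qed

section \<open>Simultaneous substitution along a list of indices\<close>

definition subs :: "'i list \<Rightarrow> ('i \<Rightarrow> 'i) \<Rightarrow> 'a \<Rightarrow> 'a"
  where "subs L \<nu> x = foldr (\<lambda>i. sub i (\<nu> i)) L x"

text \<open>The new indices avoid the old ones, so that the substitutions do not interfere.\<close>

definition admissible :: "'i list \<Rightarrow> ('i \<Rightarrow> 'i) \<Rightarrow> bool"
  where "admissible L \<nu> \<longleftrightarrow> distinct L \<and> set L \<subseteq> \<alpha> \<and> (\<forall>i\<in>set L. \<nu> i \<in> \<alpha> - set L)"

lemma subs_simps [simp]: "subs [] \<nu> x = x" "subs (i # L) \<nu> x = sub i (\<nu> i) (subs L \<nu> x)"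
  by (simp_all add: subs_def)

lemma admissible_Cons:
  "admissible (i # L) \<nu> \<Longrightarrow> admissible L \<nu> \<and> i \<in> \<alpha> \<and> \<nu> i \<in> \<alpha> \<and> \<nu> i \<noteq> i \<and> i \<notin> set L \<and> (\<forall>j\<in>set L. \<nu> j \<noteq> i)"
  by (auto simp: admissible_def)

lemma admissible_remove1: "admissible L \<nu> \<Longrightarrow> admissible (remove1 i L) \<nu>"
  by (auto simp: admissible_def)

lemma subs_cong: "(\<And>i. i \<in> set L \<Longrightarrow> \<nu> i = \<nu>' i) \<Longrightarrow> subs L \<nu> x = subs L \<nu>' x"
  by (induction L) auto

lemma subs_closed [simp]: "\<lbrakk>admissible L \<nu>; x \<in> carrier A\<rbrakk> \<Longrightarrow> subs L \<nu> x \<in> carrier A"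
  by (induction L) (auto dest: admissible_Cons)

lemma subs_join:
  "\<lbrakk>admissible L \<nu>; x \<in> carrier A; y \<in> carrier A\<rbrakk> \<Longrightarrow> subs L \<nu> (x \<oplus> y) = subs L \<nu> x \<oplus> subs L \<nu> y"
  by (induction L) (auto dest!: admissible_Cons simp: sub_join)

lemma subs_compl: "\<lbrakk>admissible L \<nu>; x \<in> carrier A\<rbrakk> \<Longrightarrow> subs L \<nu> (\<sim> x) = \<sim> subs L \<nu> x"
  by (induction L) (auto dest!: admissible_Cons simp: sub_compl)

lemma subs_fixed:
  "\<lbrakk>admissible L \<nu>; x \<in> carrier A; \<And>i. i \<in> set L \<Longrightarrow> cfix i x\<rbrakk> \<Longrightarrow> subs L \<nu> x = x"
  by (induction L) (auto dest!: admissible_Cons simp: sub_cyl)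

lemma cfix_subs:
  "\<lbrakk>admissible L \<nu>; x \<in> carrier A; j \<in> \<alpha>; cfix j x; j \<notin> \<nu> ` set L\<rbrakk> \<Longrightarrow> cfix j (subs L \<nu> x)"
  by (induction L) (auto dest!: admissible_Cons intro!: cfix_sub)

lemma subs_cyl:
  "\<lbrakk>admissible L \<nu>; x \<in> carrier A; j \<in> \<alpha>; j \<notin> set L; j \<notin> \<nu> ` set L\<rbrakk> \<Longrightarrow> subs L \<nu> (cyl A j x) = cyl A j (subs L \<nu> x)"
  by (induction L) (auto dest!: admissible_Cons simp: sub_cyl_other)

text \<open>Sources and targets are disjoint, so the single substitutions commute and any of them
  may be performed last.\<close>

lemma subs_remove1:
  "\<lbrakk>admissible L \<nu>; x \<in> carrier A; i \<in> set L\<rbrakk> \<Longrightarrow> subs L \<nu> x = sub i (\<nu> i) (subs (remove1 i L) \<nu> x)"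
proof (induction L)
  case (Cons j L)
  show ?case
  proof (cases "i = j")
    case False
    have *: "i \<in> \<alpha>" "j \<in> \<alpha>" "\<nu> i \<in> \<alpha>" "\<nu> j \<in> \<alpha>" "\<nu> i \<noteq> j" "\<nu> j \<noteq> i" "admissible L \<nu>"
      using Cons.prems False by (auto simp: admissible_def)
    then show ?thesis
      using Cons False admissible_remove1[OF *(7), of i] by (simp add: sub_commute)
  qed simp
qed simp

text \<open>A cylindrified coordinate has no value to replace: the substitution for \<open>i\<close>
  acts trivially and the others pass through.\<close>

lemma subs_cyl_mem:
  assumes "admissible L \<nu>" "x \<in> carrier A" "i \<in> set L"
  shows "subs L \<nu> (cyl A i x) = cyl A i (subs (remove1 i L) \<nu> x)"
proof -
  have *: "i \<in> \<alpha>" "\<nu> i \<in> \<alpha>" "\<nu> i \<noteq> i" "i \<notin> set (remove1 i L)" "i \<notin> \<nu> ` set (remove1 i L)"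
    using assms by (auto simp: admissible_def)
  note a = admissible_remove1[OF assms(1), of i]
  have "subs L \<nu> (cyl A i x) = sub i (\<nu> i) (cyl A i (subs (remove1 i L) \<nu> x))"
    using assms * a by (simp add: subs_remove1 subs_cyl)
  then show ?thesis
    using assms * a by (simp add: sub_cyl cfix_cyl)
qed

lemma subs_diag:
  assumes L: "admissible L \<nu>" and ij: "i \<in> set L" "j \<in> set L" "i \<noteq> j"
  shows "subs L \<nu> (diag A i j) = diag A (\<nu> i) (\<nu> j)"
proof -
  let ?L = "remove1 j (remove1 i L)"
  have *: "i \<in> \<alpha>" "j \<in> \<alpha>" "\<nu> i \<in> \<alpha>" "\<nu> j \<in> \<alpha>" "\<nu> i \<notin> {i, j}" "\<nu> j \<notin> {i, j}"
    using assms by (auto simp: admissible_def)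
  note a = admissible_remove1[OF L, of i] admissible_remove1[OF admissible_remove1[OF L, of i], of j]
  have "distinct L" "set L \<subseteq> \<alpha>"
    using L by (auto simp: admissible_def)
  then have "subs ?L \<nu> (diag A i j) = diag A i j"
    using * a ij by (intro subs_fixed cfix_diag) auto
  then have "subs L \<nu> (diag A i j) = sub i (\<nu> i) (sub j (\<nu> j) (diag A i j))"
    using L a ij * by (simp add: subs_remove1[of L _ _ i] subs_remove1[of "remove1 i L" _ _ j])
  also have "sub j (\<nu> j) (diag A i j) = diag A i (\<nu> j)"
    using * ij sub_diag[of j i "\<nu> j"] diag_commute[of i j] diag_commute[of i "\<nu> j"] by (metis insertCI)
  also have "sub i (\<nu> i) (diag A i (\<nu> j)) = diag A (\<nu> i) (\<nu> j)"
    using * sub_diag[of i "\<nu> j" "\<nu> i"] by auto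
  finally show ?thesis .
qed

text \<open>Cylindrifying at the fresh target turns \<open>sub i (\<nu> i) y\<close> into
  \<open>cyl A i y\<close>, which is nonzero if \<open>y\<close> is. Injectivity keeps the next
  target untouched by the substitutions already made.\<close>

lemma subs_nonzero:
  "\<lbrakk>admissible L \<nu>; inj_on \<nu> (set L); x \<in> carrier A; x \<noteq> \<zero>; \<And>i. i \<in> set L \<Longrightarrow> cfix (\<nu> i) x\<rbrakk>
    \<Longrightarrow> subs L \<nu> x \<noteq> \<zero>"
proof (induction L)
  case (Cons i L)
  let ?y = "subs L \<nu> x"
  note a = admissible_Cons[OF Cons.prems(1)]
  have y: "?y \<in> carrier A" "?y \<noteq> \<zero>"
    using Cons a by auto
  have "cfix (\<nu> i) ?y"
    using Cons.prems a by (intro cfix_subs) auto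
  then have "cyl A (\<nu> i) (sub i (\<nu> i) ?y) = cyl A i ?y"
    using a y by (intro cyl_sub_fresh) auto
  moreover have "cyl A i ?y \<noteq> \<zero>"
    using y ex_point[OF y] cyl_le[of _ i ?y] a point_bot by metis
  ultimately show ?case
    using a by auto
qed simp

end

section \<open>Representing endo-dimension-complemented algebras\<close>

text \<open>
  Names of the elements of the base of a representation: \<open>Wit \<tau> i a\<close> names a witness for
  \<open>c\<^sub>i a\<close> at the sequence \<open>\<tau>\<close>.
\<close>

datatype ('i, 'a) nm = Base 'i | Wit "'i \<Rightarrow> ('i, 'a) nm" 'i 'a

type_synonym ('i, 'a) task = "('i \<Rightarrow> ('i, 'a) nm) \<times> 'i \<times> 'a"

definition wit :: "('i, 'a) task \<Rightarrow> ('i, 'a) nm"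
  where "wit q = (case q of (\<tau>, i, a) \<Rightarrow> Wit \<tau> i a)"

lemma wit_simp [simp]: "wit (\<tau>, i, a) = Wit \<tau> i a"
  by (simp add: wit_def)

lemma inj_wit: "wit q = wit q' \<longleftrightarrow> q = q'"
  by (cases q; cases q') auto

lemma wit_neq_Base: "wit q \<noteq> Base i"
  by (cases q) auto

lemma wf_subname: "wf {(u, w). \<exists>\<tau> i a k. w = Wit \<tau> i a \<and> u = \<tau> k}"
proof (rule wfUNIVI)
  fix P w
  assume *: "\<forall>w. (\<forall>u. (u, w) \<in> {(u, w). \<exists>\<tau> i a k. w = Wit \<tau> i a \<and> u = \<tau> k} \<longrightarrow> P u) \<longrightarrow> P w"
  show "P w"
  proof (induction w)
    case (Base i)
    show ?case
      using *[rule_format, of "Base i"] by auto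
  next
    case (Wit \<tau> i a)
    then show ?case
      using *[rule_format, of "Wit \<tau> i a"] by auto
  qed
qed

text \<open>Being an entry of a witness's sequence is a well-founded, hence acyclic relation, so its
  converse is well-founded on a finite set. The task found has a name that no task mentions; it can
  act as a fresh constant after all others have been met.\<close>

lemma ex_last_task:
  assumes "finite Q" "Q \<noteq> {}"
  shows "\<exists>q\<in>Q. \<forall>q'\<in>Q. wit q \<notin> range (fst q')"
proof -
  let ?R = "{(u, w). \<exists>\<tau> i a k. w = Wit \<tau> i a \<and> u = \<tau> k} \<inter> (wit ` Q \<times> wit ` Q)"
  have "finite ?R"
    using assms(1) by auto
  moreover have "acyclic ?R"
    using wf_acyclic[OF wf_subname] by (rule acyclic_subset) auto
  ultimately have "wf (?R\<inverse>)"
    by (rule finite_acyclic_wf_converse)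
  moreover obtain q0 where "q0 \<in> Q"
    using assms(2) by auto
  ultimately obtain z where z: "z \<in> wit ` Q" "\<And>y. (y, z) \<in> ?R\<inverse> \<Longrightarrow> y \<notin> wit ` Q"
    using wfE_min[of "?R\<inverse>" "wit q0" "wit ` Q"] by blast
  from z(1) obtain q where q: "q \<in> Q" "z = wit q"
    by blast
  have "wit q \<notin> range (fst q')" if "q' \<in> Q" for q'
  proof
    assume "wit q \<in> range (fst q')"
    then have "\<exists>\<tau> i a k. wit q' = Wit \<tau> i a \<and> z = \<tau> k"
      using q(2) by (cases q') auto
    moreover have "wit q' \<in> wit ` Q"
      using that by blast
    ultimately have "(wit q', z) \<in> ?R\<inverse>"
      using z(1) by simp
    then show False
      using z(2) that by blast
  qed
  then show ?thesis
    using q by blast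
qed

text \<open>A homomorphism into the full set algebra of a single square; in the clause for
  \<open>cyl\<close>, the first clause bounds \<open>u\<close>.\<close>

definition represents ::
    "'i set \<Rightarrow> ('a, 'i) cyl_structure \<Rightarrow> 'u set \<Rightarrow> ('a \<Rightarrow> ('i \<Rightarrow> 'u) set) \<Rightarrow> bool"
  where "represents I A U f \<longleftrightarrow>
    (\<forall>a\<in>carrier A. f a \<subseteq> I \<rightarrow>\<^sub>E U) \<and>
    (\<forall>a\<in>carrier A. \<forall>b\<in>carrier A. f (join A a b) = f a \<union> f b) \<and>
    (\<forall>a\<in>carrier A. f (compl A a) = (I \<rightarrow>\<^sub>E U) - f a) \<and>
    (\<forall>i\<in>I. \<forall>a\<in>carrier A. f (cyl A i a) = {s \<in> I \<rightarrow>\<^sub>E U. \<exists>u. s(i := u) \<in> f a}) \<and>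
    (\<forall>i\<in>I. \<forall>j\<in>I. f (diag A i j) = {s \<in> I \<rightarrow>\<^sub>E U. s i = s j})"

lemma cyl_hom_comp:
  "\<lbrakk>h \<in> cyl_hom \<Gamma> A B; g \<in> cyl_hom \<Gamma>' B C; \<Gamma> \<subseteq> \<Gamma>'\<rbrakk> \<Longrightarrow> g \<circ> h \<in> cyl_hom \<Gamma> A C"
  by (auto simp: cyl_hom_def Pi_iff subset_iff)

section \<open>Henkin witnesses inside an endo-dimension-complemented algebra\<close>

locale edc_extension = cylindric_algebra I B
  for I :: "'i set" and B :: "('b, 'i) cyl_structure" +
  fixes A :: "('a, 'i) cyl_structure" and \<iota> :: "'a \<Rightarrow> 'b"
  assumes infinite_I: "infinite I"
    and edc: "endo_dimension_complemented I B"
    and closed_A: "closed_under I A (carrier A)"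
    and hom: "\<iota> \<in> cyl_hom I A B"
begin

lemma closed_A' [simp]:
  "\<lbrakk>a \<in> carrier A; b \<in> carrier A\<rbrakk> \<Longrightarrow> join A a b \<in> carrier A"
  "a \<in> carrier A \<Longrightarrow> compl A a \<in> carrier A"
  "\<lbrakk>i \<in> I; a \<in> carrier A\<rbrakk> \<Longrightarrow> cyl A i a \<in> carrier A"
  "\<lbrakk>i \<in> I; j \<in> I\<rbrakk> \<Longrightarrow> diag A i j \<in> carrier A"
  using closed_A by (auto simp: closed_under_def)

text \<open>Each further endomorphism is taken for \<open>G \<union> K\<close>. It commutes with the
  cylindrifications in \<open>K\<close>, so indices freed earlier stay free, and the one it frees is
  new.\<close>

lemma iterate_edc:
  assumes G: "finite G" "G \<subseteq> I" and x: "x \<in> carrier A" "\<iota> x \<noteq> \<zero>\<^bsub>B\<^esub>"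
  shows "\<exists>K h. finite K \<and> card K = m \<and> K \<subseteq> I - G \<and> h \<in> cyl_hom G A B \<and> h x \<noteq> \<zero>\<^bsub>B\<^esub> \<and>
    (\<forall>k\<in>K. \<forall>a\<in>carrier A. cfix k (h a))"
proof (induction m)
  case 0
  have "\<iota> \<in> cyl_hom G A B"
    using hom G(2) unfolding cyl_hom_def by blast
  then show ?case
    using x by (intro exI[of _ "{}"] exI[of _ \<iota>]) simp
next
  case (Suc m)
  then obtain K h where K: "finite K" "card K = m" "K \<subseteq> I - G" and h: "h \<in> cyl_hom G A B" "h x \<noteq> \<zero>\<^bsub>B\<^esub>"
    and K_fix: "\<And>k a. \<lbrakk>k \<in> K; a \<in> carrier A\<rbrakk> \<Longrightarrow> cfix k (h a)"
    by blast
  have hc: "h a \<in> carrier B" if "a \<in> carrier A" for a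
    using h(1) that by (auto simp: cyl_hom_def)
  have "\<exists>\<kappa>\<in>I - (G \<union> K). \<exists>g\<in>cyl_hom (G \<union> K) B B. g (h x) \<noteq> \<zero>\<^bsub>B\<^esub> \<and> (\<forall>a\<in>carrier B. cyl B \<kappa> (g a) = g a)"
    using edc[unfolded endo_dimension_complemented_def, rule_format, of "G \<union> K" "h x"] G K h x hc by auto
  then obtain \<kappa> g where \<kappa>: "\<kappa> \<in> I - (G \<union> K)" and g: "g \<in> cyl_hom (G \<union> K) B B" "g (h x) \<noteq> \<zero>\<^bsub>B\<^esub>"
    "\<And>a. a \<in> carrier B \<Longrightarrow> cyl B \<kappa> (g a) = g a"
    by blast
  have "cfix k ((g \<circ> h) a)" if "k \<in> insert \<kappa> K" "a \<in> carrier A" for k a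
  proof (cases "k = \<kappa>")
    case True
    then show ?thesis
      using g(3) hc that by (simp add: cfix_def)
  next
    case False
    then have "cyl B k (g (h a)) = g (cyl B k (h a))"
      using g(1) that hc by (simp add: cyl_hom_def)
    then show ?thesis
      using K_fix[of k a] False that by (simp add: cfix_def)
  qed
  moreover have "g \<circ> h \<in> cyl_hom G A B"
    using cyl_hom_comp[OF h(1) g(1)] by auto
  ultimately show ?case
    using K \<kappa> g(2) by (intro exI[of _ "insert \<kappa> K"] exI[of _ "g \<circ> h"]) (auto simp: comp_def)
qed

text \<open>
  A frame interprets the coordinates in \<open>L\<close> of an element \<open>h a\<close> and assigns to each name an index
  outside \<open>L\<close>; \<open>ev\<close> expresses that \<open>a\<close> holds at the sequence \<open>\<tau>\<close> of names.
\<close>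

definition frame :: "'i list \<Rightarrow> (('i, 'a) nm \<Rightarrow> 'i) \<Rightarrow> ('a \<Rightarrow> 'b) \<Rightarrow> bool"
  where "frame L n h \<longleftrightarrow> distinct L \<and> set L \<subseteq> I \<and> (\<forall>w. n w \<in> I - set L) \<and> h \<in> cyl_hom (set L) A B"

definition ev :: "'i list \<Rightarrow> (('i, 'a) nm \<Rightarrow> 'i) \<Rightarrow> ('a \<Rightarrow> 'b) \<Rightarrow> ('i \<Rightarrow> ('i, 'a) nm) \<Rightarrow> 'a \<Rightarrow> 'b"
  where "ev L n h \<tau> a = subs L (\<lambda>i. n (\<tau> i)) (h a)"

lemma frame_admissible: "frame L n h \<Longrightarrow> admissible L (\<lambda>i. n (\<tau> i))"
  by (auto simp: frame_def admissible_def)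

lemma frame_hom:
  assumes "frame L n h"
  shows "a \<in> carrier A \<Longrightarrow> h a \<in> carrier B"
    and "\<lbrakk>a \<in> carrier A; b \<in> carrier A\<rbrakk> \<Longrightarrow> h (join A a b) = join B (h a) (h b)"
    and "a \<in> carrier A \<Longrightarrow> h (compl A a) = compl B (h a)"
    and "\<lbrakk>i \<in> set L; a \<in> carrier A\<rbrakk> \<Longrightarrow> h (cyl A i a) = cyl B i (h a)"
    and "\<lbrakk>i \<in> set L; j \<in> set L\<rbrakk> \<Longrightarrow> h (diag A i j) = diag B i j"
  using assms by (auto simp: frame_def cyl_hom_def)

lemma ev_closed: "\<lbrakk>frame L n h; a \<in> carrier A\<rbrakk> \<Longrightarrow> ev L n h \<tau> a \<in> carrier B"
  by (simp add: ev_def frame_admissible frame_hom)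

lemma ev_join:
  "\<lbrakk>frame L n h; a \<in> carrier A; b \<in> carrier A\<rbrakk> \<Longrightarrow> ev L n h \<tau> (join A a b) = join B (ev L n h \<tau> a) (ev L n h \<tau> b)"
  by (simp add: ev_def frame_admissible frame_hom subs_join)

lemma ev_compl: "\<lbrakk>frame L n h; a \<in> carrier A\<rbrakk> \<Longrightarrow> ev L n h \<tau> (compl A a) = compl B (ev L n h \<tau> a)"
  by (simp add: ev_def frame_admissible frame_hom subs_compl)

lemma ev_diag:
  assumes "frame L n h" "i \<in> set L" "j \<in> set L" "i \<noteq> j"
  shows "ev L n h \<tau> (diag A i j) = diag B (n (\<tau> i)) (n (\<tau> j))"
  using assms subs_diag[OF frame_admissible[OF assms(1)], of i j \<tau>] by (simp add: ev_def frame_hom)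

lemma ev_diag_refl:
  assumes "frame L n h" "i \<in> set L"
  shows "ev L n h \<tau> (diag A i i) = \<one>\<^bsub>B\<^esub>"
proof -
  have "set L \<subseteq> I"
    using assms by (simp add: frame_def)
  then show ?thesis
    using assms subs_fixed[OF frame_admissible[OF assms(1)], of "\<one>\<^bsub>B\<^esub>" \<tau>]
    by (auto simp: ev_def frame_hom diag_refl subset_iff cfix_def)
qed

text \<open>The value with coordinate \<open>i\<close> left open. Applying \<open>cyl B i\<close>
  gives \<open>cyl A i a\<close> at the sequence, and \<open>sub i\<close> gives \<open>a\<close> at
  its updates, which makes the two comparable.\<close>

definition ev_rest :: "'i list \<Rightarrow> (('i, 'a) nm \<Rightarrow> 'i) \<Rightarrow> ('a \<Rightarrow> 'b) \<Rightarrow> ('i \<Rightarrow> ('i, 'a) nm) \<Rightarrow> 'i \<Rightarrow> 'a \<Rightarrow> 'b"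
  where "ev_rest L n h \<tau> i a = subs (remove1 i L) (\<lambda>j. n (\<tau> j)) (h a)"

lemma ev_rest_closed: "\<lbrakk>frame L n h; a \<in> carrier A\<rbrakk> \<Longrightarrow> ev_rest L n h \<tau> i a \<in> carrier B"
  by (simp add: ev_rest_def frame_admissible frame_hom admissible_remove1)

lemma ev_cyl: "\<lbrakk>frame L n h; i \<in> set L; a \<in> carrier A\<rbrakk> \<Longrightarrow> ev L n h \<tau> (cyl A i a) = cyl B i (ev_rest L n h \<tau> i a)"
  using subs_cyl_mem[OF frame_admissible] by (simp add: ev_def ev_rest_def frame_hom)

lemma ev_upd:
  assumes "frame L n h" "i \<in> set L" "a \<in> carrier A"
  shows "ev L n h (\<tau>(i := w)) a = sub i (n w) (ev_rest L n h \<tau> i a)"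
proof -
  have "i \<notin> set (remove1 i L)"
    using assms(1) by (simp add: frame_def)
  then have "subs (remove1 i L) (\<lambda>j. n ((\<tau>(i := w)) j)) (h a) = ev_rest L n h \<tau> i a"
    unfolding ev_rest_def by (intro subs_cong) auto
  then show ?thesis
    using subs_remove1[OF frame_admissible[OF assms(1)], of "h a" i "\<tau>(i := w)"] assms by (simp add: ev_def frame_hom)
qed

text \<open>The Henkin axiom for one task, read at the ultrafilter \<open>p\<close>.\<close>

definition solves :: "'i list \<Rightarrow> (('i, 'a) nm \<Rightarrow> 'i) \<Rightarrow> ('a \<Rightarrow> 'b) \<Rightarrow> ('b \<Rightarrow> bool) \<Rightarrow> ('i, 'a) task \<Rightarrow> bool"
  where "solves L n h p q \<longleftrightarrow> (case q of (\<tau>, i, a) \<Rightarrow>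
    p (ev L n h \<tau> (cyl A i a)) \<longrightarrow> p (ev L n h (\<tau>(i := Wit \<tau> i a)) a))"

text \<open>Tasks are imposed one at a time on a nonzero element. The last clause carries the
  induction: indices in \<open>K\<close> of names not yet used do not affect \<open>e\<close>, so
  they are still fresh when needed.\<close>

lemma ex_solution:
  assumes fr: "frame L n h" and x: "x \<in> carrier A" "h x \<noteq> \<zero>\<^bsub>B\<^esub>"
    and K: "K \<subseteq> I" "\<And>k a. \<lbrakk>k \<in> K; a \<in> carrier A\<rbrakk> \<Longrightarrow> cfix k (h a)"
    and n: "inj_on n N" "n ` N \<subseteq> K"
    and Q: "finite Q" "\<And>\<tau> i a. (\<tau>, i, a) \<in> Q \<Longrightarrow> i \<in> set L \<and> a \<in> carrier A"
    and N: "Base ` set L \<subseteq> N" "\<And>q. q \<in> Q \<Longrightarrow> insert (wit q) (fst q ` set L) \<subseteq> N"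
  shows "\<exists>e\<in>carrier B. e \<noteq> \<zero>\<^bsub>B\<^esub> \<and>
    (\<forall>p. point p \<longrightarrow> p e \<longrightarrow> p (ev L n h Base x) \<and> (\<forall>q\<in>Q. solves L n h p q)) \<and>
    (\<forall>k\<in>K - n ` (Base ` set L \<union> (\<Union>q\<in>Q. insert (wit q) (fst q ` set L))). cfix k e)"
  using Q(1)
proof (induction rule: finite_remove_induct)
  case empty
  let ?e = "ev L n h Base x"
  have LI: "set L \<subseteq> I"
    using fr by (simp add: frame_def)
  have "inj_on (\<lambda>i. n (Base i)) (set L)"
    using comp_inj_on[of Base "set L" n] inj_on_subset[OF n(1) N(1)] by (simp add: inj_on_def comp_def)
  then have "?e \<noteq> \<zero>\<^bsub>B\<^esub>"
    unfolding ev_def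
  proof (intro subs_nonzero frame_admissible fr)
    show "cfix (n (Base i)) (h x)" if "i \<in> set L" for i
      using that K(2) x(1) n(2) N(1) by blast
  qed (use x fr in \<open>auto simp: frame_hom\<close>)
  moreover have "cfix k ?e" if "k \<in> K - n ` Base ` set L" for k
    unfolding ev_def using that x K fr by (intro cfix_subs frame_admissible) (auto simp: frame_hom)
  ultimately show ?case
    using ev_closed[OF fr x(1)] by (intro bexI[of _ ?e]) auto
next
  case (remove R)
  \<comment> \<open>As no task in \<open>R\<close> mentions this name, its index affects neither the
    element built for the other tasks nor \<open>?y\<close> below.\<close>
  obtain q where q: "q \<in> R" "\<And>q'. q' \<in> R \<Longrightarrow> wit q \<notin> range (fst q')"
    using ex_last_task[OF remove(1,2)] by blast
  obtain \<tau> i a where q_eq: "q = (\<tau>, i, a)"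
    by (cases q)
  let ?names = "\<lambda>R. Base ` set L \<union> (\<Union>q\<in>R. insert (wit q) (fst q ` set L))"
  obtain e where e: "e \<in> carrier B" "e \<noteq> \<zero>\<^bsub>B\<^esub>"
    "\<forall>p. point p \<longrightarrow> p e \<longrightarrow> p (ev L n h Base x) \<and> (\<forall>q\<in>R - {q}. solves L n h p q)"
    "\<forall>k\<in>K - n ` ?names (R - {q}). cfix k e"
    using remove(4)[OF q(1)] by (elim bexE conjE) (rule that)
  have RN: "?names R \<subseteq> N"
    using N remove(3) by blast
  have ia: "i \<in> set L" "a \<in> carrier A"
    using Q(2) q(1) remove(3) q_eq by blast+
  have iI: "i \<in> I" "\<And>w. n w \<in> I" "\<And>w. n w \<noteq> i"
    using ia(1) fr by (auto simp: frame_def)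
  let ?\<kappa> = "n (wit q)" and ?y = "ev_rest L n h \<tau> i a"
  have y: "?y \<in> carrier B"
    using ev_rest_closed[OF fr ia(2)] .
  have \<kappa>K: "?\<kappa> \<in> K"
    using RN q(1) n(2) by blast
  have fresh: "?\<kappa> \<notin> n ` M" if "wit q \<notin> M" "M \<subseteq> N" for M
  proof
    assume "?\<kappa> \<in> n ` M"
    then obtain w where "w \<in> M" "n w = ?\<kappa>"
      by auto
    then have "w = wit q"
      using that(2) inj_onD[OF n(1), of w "wit q"] RN q(1) by blast
    then show False
      using \<open>w \<in> M\<close> that(1) by simp
  qed
  have "wit q \<notin> insert (wit q') (fst q' ` set L)" if "q' \<in> R - {q}" for q'
    using q(2)[of q'] inj_wit[of q q'] that by auto
  moreover have "wit q \<notin> Base ` set L"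
    using wit_neq_Base[of q] by auto
  ultimately have "wit q \<notin> ?names (R - {q})"
    by blast
  moreover have sub_names: "?names (R - {q}) \<subseteq> ?names R"
    by auto
  ultimately have "?\<kappa> \<in> K - n ` ?names (R - {q})"
    using \<kappa>K fresh[OF _ order_trans[OF sub_names RN]] by simp
  with e(4) have \<kappa>e: "cfix ?\<kappa> e" ..
  have \<tau>N: "\<tau> ` set L \<subseteq> N"
    using N(2)[of q] q(1) remove(3) q_eq by auto
  have cfix_y: "cfix k ?y" if "k \<in> K" "k \<notin> n ` \<tau> ` set L" for k
    unfolding ev_rest_def using that ia K set_remove1_subset[of i L]
    by (intro cfix_subs admissible_remove1 frame_admissible[OF fr]) (auto simp: frame_hom[OF fr])
  have "wit q \<notin> \<tau> ` set L"
    using q(2)[OF q(1)] q_eq by auto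
  then have \<kappa>y: "cfix ?\<kappa> ?y"
    using cfix_y \<kappa>K fresh[of "\<tau> ` set L"] \<tau>N by blast
  let ?y1 = "cyl B i ?y" and ?y2 = "sub i ?\<kappa> ?y"
  have y12: "ev L n h \<tau> (cyl A i a) = ?y1" "ev L n h (\<tau>(i := Wit \<tau> i a)) a = ?y2"
    using ev_cyl[OF fr ia] ev_upd[OF fr ia] q_eq by simp_all
  have yc: "?y1 \<in> carrier B" "?y2 \<in> carrier B"
    using y iI by auto
  \<comment> \<open>The Henkin condition for \<open>q\<close>. Cylindrified at
    \<open>?\<kappa>\<close> it becomes the unit, since \<open>?y2\<close> then becomes
    \<open>?y1\<close>; so its meet with an \<open>e\<close> not affected by
    \<open>?\<kappa>\<close> is nonzero.\<close>
  let ?t = "\<sim>\<^bsub>B\<^esub> ?y1 \<oplus>\<^bsub>B\<^esub> ?y2"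
  have "cyl B ?\<kappa> ?y1 = ?y1"
    using cfix_cyl_other[OF iI(1) iI(2) y \<kappa>y] by (simp add: cfix_def)
  then have \<kappa>y1: "cyl B ?\<kappa> (\<sim>\<^bsub>B\<^esub> ?y1) = \<sim>\<^bsub>B\<^esub> ?y1"
    using cfix_compl[OF iI(2) yc(1)] by (simp add: cfix_def)
  have "cyl B ?\<kappa> ?y2 = ?y1"
    using cyl_sub_fresh[OF iI(1) iI(2) iI(3) y \<kappa>y] .
  then have "cyl B ?\<kappa> ?t = \<one>\<^bsub>B\<^esub>"
    using yc iI \<kappa>y1 join_comm[of "\<sim>\<^bsub>B\<^esub> ?y1" ?y1] by (simp add: cyl_join join_compl)
  then have "cyl B ?\<kappa> (?t \<odot>\<^bsub>B\<^esub> e) = \<one>\<^bsub>B\<^esub> \<odot>\<^bsub>B\<^esub> e"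
    using cyl_meet_cfix[OF iI(2) _ e(1) \<kappa>e, of ?t] yc by simp
  also have "\<dots> = e"
    using e(1) meet_comm[of "\<one>\<^bsub>B\<^esub>" e] by (simp add: meet_top)
  finally have ne: "?t \<odot>\<^bsub>B\<^esub> e \<noteq> \<zero>\<^bsub>B\<^esub>"
    using e(2) iI by auto
  show ?case
  proof (intro bexI[of _ "?t \<odot>\<^bsub>B\<^esub> e"] conjI allI impI ballI)
    show "?t \<odot>\<^bsub>B\<^esub> e \<noteq> \<zero>\<^bsub>B\<^esub>"
      by (rule ne)
    show "?t \<odot>\<^bsub>B\<^esub> e \<in> carrier B"
      using yc e(1) by simp
  next
    fix p assume p: "point p" "p (?t \<odot>\<^bsub>B\<^esub> e)"
    then have pt: "p ?t" "p e"
      using yc e(1) by auto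
    have sol: "p (ev L n h Base x) \<and> (\<forall>q\<in>R - {q}. solves L n h p q)"
      using e(3)[rule_format, OF p(1) pt(2)] .
    then show "p (ev L n h Base x)" ..
    fix q' assume q': "q' \<in> R"
    show "solves L n h p q'"
    proof (cases "q' = q")
      case True
      then show ?thesis
        using pt(1) p(1) yc y12 q_eq by (auto simp: solves_def)
    next
      case False
      then show ?thesis
        using sol q' by blast
    qed
  next
    fix k assume k: "k \<in> K - n ` ?names R"
    then have kI: "k \<in> I" "k \<noteq> ?\<kappa>"
      using K(1) q(1) by auto
    have "k \<notin> n ` \<tau> ` set L"
      using k q(1) q_eq by force
    then have "cfix k ?y"
      using cfix_y k by blast
    then have "cfix k ?y1" "cfix k ?y2"
      using cfix_cyl_other[OF iI(1) kI(1) y] cfix_sub[OF iI(1) iI(2) kI(1) _ y] kI(2) by blast+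
    then have "cfix k ?t"
      using kI yc by (intro cfix_join cfix_compl) auto
    have "k \<in> K - n ` ?names (R - {q})"
      using k image_mono[OF sub_names, of n] by blast
    with e(4) have "cfix k e" ..
    with \<open>cfix k ?t\<close> show "cfix k (?t \<odot>\<^bsub>B\<^esub> e)"
      using kI yc e(1) by (intro cfix_meet) auto
  qed
qed

lemma ex_frame:
  assumes x: "x \<in> carrier A" "\<iota> x \<noteq> \<zero>\<^bsub>B\<^esub>" and T: "finite T" "T \<subseteq> I"
    and Q: "finite Q" "\<And>\<tau> i a. (\<tau>, i, a) \<in> Q \<Longrightarrow> i \<in> I \<and> a \<in> carrier A"
  shows "\<exists>L n h p. frame L n h \<and> point p \<and> T \<subseteq> set L \<and> (\<forall>(\<tau>, i, a)\<in>Q. i \<in> set L) \<and>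
    p (ev L n h Base x) \<and> (\<forall>q\<in>Q. solves L n h p q)"
proof -
  let ?G = "T \<union> (fst \<circ> snd) ` Q"
  have G: "finite ?G" "?G \<subseteq> I"
    using T Q by auto
  obtain L where L: "set L = ?G" "distinct L"
    using finite_distinct_list[OF G(1)] by blast
  define N where "N = Base ` set L \<union> (\<Union>q\<in>Q. insert (wit q) (fst q ` set L))"
  have N: "finite N"
    using Q(1) by (auto simp: N_def)
  \<comment> \<open>\<open>Suc\<close> keeps \<open>K\<close> nonempty, so that a default index
    exists for the names outside \<open>N\<close>.\<close>
  obtain K h where K: "finite K" "card K = Suc (card N)" "K \<subseteq> I - set L"
    and h: "h \<in> cyl_hom (set L) A B" "h x \<noteq> \<zero>\<^bsub>B\<^esub>" "\<And>k a. \<lbrakk>k \<in> K; a \<in> carrier A\<rbrakk> \<Longrightarrow> cfix k (h a)"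
    using iterate_edc[OF _ _ x, of "set L" "Suc (card N)"] G L by auto
  obtain g where g: "g ` N \<subseteq> K" "inj_on g N"
    using card_le_inj[OF N K(1)] K(2) by auto
  have "K \<noteq> {}"
    using K(2) by auto
  then obtain k0 where k0: "k0 \<in> K"
    by blast
  define n where "n w = (if w \<in> N then g w else k0)" for w
  have n: "inj_on n N" "n w \<in> K" for w
    using g k0 by (auto simp: n_def inj_on_def)
  have fr: "frame L n h"
    using n(2) L G K(3) h(1) by (auto simp: frame_def)
  have N_props: "Base ` set L \<subseteq> N" "\<And>q. q \<in> Q \<Longrightarrow> insert (wit q) (fst q ` set L) \<subseteq> N"
    by (auto simp: N_def)
  have "\<exists>e\<in>carrier B. e \<noteq> \<zero>\<^bsub>B\<^esub> \<and>
    (\<forall>p. point p \<longrightarrow> p e \<longrightarrow> p (ev L n h Base x) \<and> (\<forall>q\<in>Q. solves L n h p q)) \<and>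
    (\<forall>k\<in>K - n ` N. cfix k e)"
  proof (rule ex_solution[OF fr x(1) h(2) _ h(3) n(1) _ Q(1) _ N_props, folded N_def])
    fix \<tau> i a assume "(\<tau>, i, a) \<in> Q"
    then show "i \<in> set L \<and> a \<in> carrier A"
      using Q(2) L(1) by force
  qed (use K n(2) in auto)
  then obtain e p where "point p" "p (ev L n h Base x)" "\<forall>q\<in>Q. solves L n h p q"
    using ex_point by metis
  moreover have "T \<subseteq> set L" "\<forall>(\<tau>, i, a)\<in>Q. i \<in> set L"
    using L(1) by force+
  ultimately show ?thesis
    using fr by blast
qed

lemma ex_valuation:
  assumes x: "x \<in> carrier A" "\<iota> x \<noteq> \<zero>\<^bsub>B\<^esub>"
  shows "\<exists>v. \<forall>T Q F. finite T \<longrightarrow> T \<subseteq> I \<longrightarrow> finite Q \<longrightarrow> Q \<subseteq> UNIV \<times> I \<times> carrier A \<longrightarrow> finite F \<longrightarrow>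
    (\<exists>L n h p. frame L n h \<and> point p \<and> T \<subseteq> set L \<and> (\<forall>(\<tau>, i, a)\<in>Q. i \<in> set L) \<and>
      p (ev L n h Base x) \<and> (\<forall>q\<in>Q. solves L n h p q) \<and> (\<forall>(\<tau>, a)\<in>F. v (\<tau>, a) \<longleftrightarrow> p (ev L n h \<tau> a)))"
proof -
  define R where "R T Q L n h p \<longleftrightarrow> frame L n h \<and> point p \<and> T \<subseteq> set L \<and> (\<forall>(\<tau>, i, a)\<in>Q. i \<in> set L) \<and>
      p (ev L n h Base x) \<and> (\<forall>q\<in>Q. solves L n h p q)" for T Q L n h p
  \<comment> \<open>The sum type lets one finite set \<open>D\<close> carry both kinds of
    requirements: coordinates on the left, tasks on the right.\<close>
  define S where "S D = {f. \<exists>L n h p. R (Inl -` D \<inter> I) (Inr -` D \<inter> (UNIV \<times> I \<times> carrier A)) L n h p \<and>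
    f = (\<lambda>(\<tau>, a). p (ev L n h \<tau> a))}" for D
  have ne: "S D \<noteq> {}" if "finite D" for D
  proof -
    have "\<exists>L n h p. R (Inl -` D \<inter> I) (Inr -` D \<inter> (UNIV \<times> I \<times> carrier A)) L n h p"
      unfolding R_def by (rule ex_frame[OF x]) (use that in \<open>auto intro!: finite_Int finite_vimageI\<close>)
    then show ?thesis
      unfolding S_def by blast
  qed
  have R_anti: "R T Q L n h p" if "R T' Q' L n h p" "T \<subseteq> T'" "Q \<subseteq> Q'" for T Q T' Q' L n h p
    using that unfolding R_def by blast
  have anti: "S D' \<subseteq> S D" if "D \<subseteq> D'" for D D'
  proof
    fix f assume "f \<in> S D'"
    then obtain L n h p where f: "f = (\<lambda>(\<tau>, a). p (ev L n h \<tau> a))"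
      and R: "R (Inl -` D' \<inter> I) (Inr -` D' \<inter> (UNIV \<times> I \<times> carrier A)) L n h p"
      by (auto simp: S_def)
    have "R (Inl -` D \<inter> I) (Inr -` D \<inter> (UNIV \<times> I \<times> carrier A)) L n h p"
      by (rule R_anti[OF R]) (use that in auto)
    then show "f \<in> S D"
      using f unfolding S_def by blast
  qed
  obtain v where v: "\<forall>D F. finite D \<longrightarrow> finite F \<longrightarrow> (\<exists>f\<in>S D. \<forall>t\<in>F. f t = v t)"
    using ex_cluster_valuation[of S] ne anti by metis
  have "\<exists>L n h p. R T Q L n h p \<and> (\<forall>(\<tau>, a)\<in>F. v (\<tau>, a) \<longleftrightarrow> p (ev L n h \<tau> a))"
    if "finite T" "T \<subseteq> I" "finite Q" "Q \<subseteq> UNIV \<times> I \<times> carrier A" "finite F" for T Q F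
  proof -
    have "\<exists>f\<in>S (Inl ` T \<union> Inr ` Q). \<forall>t\<in>F. f t = v t"
      using v[rule_format, of "Inl ` T \<union> Inr ` Q" F] that by simp
    then obtain f where f: "f \<in> S (Inl ` T \<union> Inr ` Q)" "\<forall>t\<in>F. f t = v t"
      by (elim bexE)
    then obtain L n h p where f_eq: "f = (\<lambda>(\<tau>, a). p (ev L n h \<tau> a))"
      and R: "R (Inl -` (Inl ` T \<union> Inr ` Q) \<inter> I) (Inr -` (Inl ` T \<union> Inr ` Q) \<inter> (UNIV \<times> I \<times> carrier A)) L n h p"
      unfolding S_def by blast
    have "R T Q L n h p"
      by (rule R_anti[OF R]) (use that in auto)
    moreover have "\<forall>(\<tau>, a)\<in>F. v (\<tau>, a) \<longleftrightarrow> p (ev L n h \<tau> a)"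
      using f(2) f_eq by auto
    ultimately show ?thesis
      by blast
  qed
  then show ?thesis
    unfolding R_def by (intro exI[of _ v]) (simp add: conj_assoc)
qed

end

section \<open>From a limit valuation to a representation on one square\<close>

context edc_extension
begin

lemma ex_representation:
  assumes x: "x \<in> carrier A" "\<iota> x \<noteq> \<zero>\<^bsub>B\<^esub>"
  shows "\<exists>(U :: ('i, 'a) nm set) f. represents I A U f \<and> f x \<noteq> {}"
proof -
  obtain v where v: "\<forall>T Q F. finite T \<longrightarrow> T \<subseteq> I \<longrightarrow> finite Q \<longrightarrow> Q \<subseteq> UNIV \<times> I \<times> carrier A \<longrightarrow> finite F \<longrightarrow>
    (\<exists>L n h p. frame L n h \<and> point p \<and> T \<subseteq> set L \<and> (\<forall>(\<tau>, i, a)\<in>Q. i \<in> set L) \<and>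
      p (ev L n h Base x) \<and> (\<forall>q\<in>Q. solves L n h p q) \<and> (\<forall>(\<tau>, a)\<in>F. v (\<tau>, a) \<longleftrightarrow> p (ev L n h \<tau> a)))"
    using ex_valuation[OF x] by (elim exE)
  have approx: "\<exists>L n h p. frame L n h \<and> point p \<and> T \<subseteq> set L \<and> p (ev L n h Base x) \<and>
      (\<forall>(\<tau>, a)\<in>F. v (\<tau>, a) \<longleftrightarrow> p (ev L n h \<tau> a))"
    if "finite T" "T \<subseteq> I" "finite F" for T F
    using v[rule_format, of T "{}" F] that by simp
  obtain i0 i1 where i01: "i0 \<in> I" "i1 \<in> I" "i0 \<noteq> i1"
    using infinite_I by (metis finite.emptyI finite_insert finite_subset insertI1 subsetI)
  \<comment> \<open>Equality of names, read off a diagonal at two fixed coordinates;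
    \<open>E_diag\<close> shows that their choice is immaterial.\<close>
  define E where "E w w' \<longleftrightarrow> v (\<lambda>k. if k = i0 then w else w', diag A i0 i1)" for w w'
  have v_Base: "v (Base, x)"
    using approx[of "{}" "{(Base, x)}"] by auto
  have v_join: "v (\<tau>, join A a b) \<longleftrightarrow> v (\<tau>, a) \<or> v (\<tau>, b)" if ab: "a \<in> carrier A" "b \<in> carrier A" for \<tau> a b
  proof -
    obtain L n h p where "frame L n h" "point p"
      and "\<forall>(\<tau>, a)\<in>{(\<tau>, a), (\<tau>, b), (\<tau>, join A a b)}. v (\<tau>, a) \<longleftrightarrow> p (ev L n h \<tau> a)"
      using approx[of "{}" "{(\<tau>, a), (\<tau>, b), (\<tau>, join A a b)}"] by auto
    then show ?thesis
      using ab by (simp add: ev_join ev_closed)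
  qed
  have v_compl: "v (\<tau>, compl A a) \<longleftrightarrow> \<not> v (\<tau>, a)" if a: "a \<in> carrier A" for \<tau> a
  proof -
    obtain L n h p where "frame L n h" "point p"
      and "\<forall>(\<tau>, a)\<in>{(\<tau>, a), (\<tau>, compl A a)}. v (\<tau>, a) \<longleftrightarrow> p (ev L n h \<tau> a)"
      using approx[of "{}" "{(\<tau>, a), (\<tau>, compl A a)}"] by auto
    then show ?thesis
      using a by (simp add: ev_compl ev_closed)
  qed
  have v_cyl: "v (\<tau>, cyl A i a)" if ia: "i \<in> I" "a \<in> carrier A" and va: "v (\<tau>(i := w), a)" for \<tau> i a w
  proof -
    obtain L n h p where fr: "frame L n h" "point p" "{i} \<subseteq> set L"
      and v: "\<forall>(\<tau>, a)\<in>{(\<tau>, cyl A i a), (\<tau>(i := w), a)}. v (\<tau>, a) \<longleftrightarrow> p (ev L n h \<tau> a)"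
      using approx[of "{i}" "{(\<tau>, cyl A i a), (\<tau>(i := w), a)}"] ia by auto
    have "n w \<in> I"
      using fr(1) by (auto simp: frame_def)
    then show ?thesis
      using fr v va ia sub_le_cyl[OF fr(2) ia(1)] ev_rest_closed[OF fr(1) ia(2)] by (auto simp: ev_cyl ev_upd)
  qed
  have v_wit: "v (\<tau>(i := Wit \<tau> i a), a)" if ia: "i \<in> I" "a \<in> carrier A" and va: "v (\<tau>, cyl A i a)" for \<tau> i a
  proof -
    let ?F = "{(\<tau>, cyl A i a), (\<tau>(i := Wit \<tau> i a), a)}"
    obtain L n h p where "\<forall>q\<in>{(\<tau>, i, a)}. solves L n h p q"
      and "\<forall>(\<tau>, a)\<in>?F. v (\<tau>, a) \<longleftrightarrow> p (ev L n h \<tau> a)"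
      using v[rule_format, of "{}" "{(\<tau>, i, a)}" ?F] ia by auto
    then show ?thesis
      using va by (auto simp: solves_def)
  qed
  have E_diag: "v (\<tau>, diag A i j) \<longleftrightarrow> E (\<tau> i) (\<tau> j)" if ij: "i \<in> I" "j \<in> I" for \<tau> i j
  proof -
    let ?F = "{(\<tau>, diag A i j), (\<lambda>k. if k = i0 then \<tau> i else \<tau> j, diag A i0 i1)}"
    obtain L n h p where fr: "frame L n h" "point p" "{i, j, i0, i1} \<subseteq> set L"
      and v: "\<forall>(\<tau>, a)\<in>?F. v (\<tau>, a) \<longleftrightarrow> p (ev L n h \<tau> a)"
      using approx[of "{i, j, i0, i1}" ?F] ij i01 by auto
    have E: "E (\<tau> i) (\<tau> j) \<longleftrightarrow> p (diag B (n (\<tau> i)) (n (\<tau> j)))"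
      using v fr i01 by (simp add: E_def ev_diag)
    show ?thesis
    proof (cases "i = j")
      case True
      have "n (\<tau> j) \<in> I"
        using fr(1) by (auto simp: frame_def)
      then show ?thesis
        using True E v fr ij by (simp add: ev_diag_refl diag_refl)
    next
      case False
      then show ?thesis
        using E v fr ij by (simp add: ev_diag)
    qed
  qed
  have E_approx: "\<exists>L n h p. frame L n h \<and> point p \<and> T \<subseteq> set L \<and>
      (\<forall>w\<in>W. \<forall>w'\<in>W. E w w' \<longleftrightarrow> p (diag B (n w) (n w'))) \<and> (\<forall>(\<tau>, a)\<in>F. v (\<tau>, a) \<longleftrightarrow> p (ev L n h \<tau> a))"
    if WF: "finite W" "finite F" "finite T" "T \<subseteq> I" for W F T
  proof -
    let ?g = "\<lambda>(w, w'). (\<lambda>k. if k = i0 then w else w', diag A i0 i1)"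
    obtain L n h p where fr: "frame L n h" "point p" "insert i0 (insert i1 T) \<subseteq> set L"
      and v: "\<forall>(\<tau>, a)\<in>F \<union> ?g ` (W \<times> W). v (\<tau>, a) \<longleftrightarrow> p (ev L n h \<tau> a)"
      using approx[of "insert i0 (insert i1 T)" "F \<union> ?g ` (W \<times> W)"] WF i01 by auto
    have "E w w' \<longleftrightarrow> p (diag B (n w) (n w'))" if "w \<in> W" "w' \<in> W" for w w'
    proof -
      have "?g (w, w') \<in> F \<union> ?g ` (W \<times> W)"
        using that by blast
      from bspec[OF v this] have "E w w' \<longleftrightarrow> p (ev L n h (\<lambda>k. if k = i0 then w else w') (diag A i0 i1))"
        by (simp add: E_def)
      then show ?thesis
        using fr i01 by (simp add: ev_diag)
    qed
    then show ?thesis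
      using fr v by (intro exI[of _ L] exI[of _ n] exI[of _ h] exI[of _ p]) auto
  qed
  have n_I: "n w \<in> I" if "frame L n h" for L n h w
    using that by (auto simp: frame_def)
  have E_refl: "E w w" for w
  proof -
    obtain L n h p where "frame L n h" "point p" "E w w \<longleftrightarrow> p (diag B (n w) (n w))"
      using E_approx[of "{w}" "{}" "{}"] by auto
    then show ?thesis
      using n_I by (simp add: diag_refl)
  qed
  have E_sym: "E w' w" if "E w w'" for w w'
  proof -
    obtain L n h p where "frame L n h" "point p" "\<forall>u\<in>{w, w'}. \<forall>u'\<in>{w, w'}. E u u' \<longleftrightarrow> p (diag B (n u) (n u'))"
      using E_approx[of "{w, w'}" "{}" "{}"] by auto
    then show ?thesis
      using that n_I diag_commute[of "n w" "n w'"] by simp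
  qed
  have E_trans: "E w w''" if "E w w'" "E w' w''" for w w' w''
  proof -
    obtain L n h p where "frame L n h" "point p"
      "\<forall>u\<in>{w, w', w''}. \<forall>u'\<in>{w, w', w''}. E u u' \<longleftrightarrow> p (diag B (n u) (n u'))"
      using E_approx[of "{w, w', w''}", OF _ finite.emptyI finite.emptyI empty_subsetI]
      by (elim meta_impE exE conjE) (simp, rule that)
    then show ?thesis
      using that n_I diag_trans_le[of p "n w" "n w'" "n w''"] by auto
  qed
  have v_subst: "v (\<tau>(i := w'), a)" if ia: "i \<in> I" "a \<in> carrier A" and w: "E w w'" and va: "v (\<tau>(i := w), a)" for \<tau> i a w w'
  proof -
    let ?F = "{(\<tau>(i := w), a), (\<tau>(i := w'), a)}"
    obtain L n h p where fr: "frame L n h" "point p" "{i} \<subseteq> set L"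
      and E: "\<forall>u\<in>{w, w'}. \<forall>u'\<in>{w, w'}. E u u' \<longleftrightarrow> p (diag B (n u) (n u'))"
      and v: "\<forall>(\<tau>, a)\<in>?F. v (\<tau>, a) \<longleftrightarrow> p (ev L n h \<tau> a)"
      using E_approx[of "{w, w'}" ?F "{i}"] ia by blast
    have "n w \<in> I" "n w' \<in> I" "i \<noteq> n w" "i \<noteq> n w'"
      using fr by (auto simp: frame_def)
    moreover have "p (diag B (n w) (n w'))"
      using E w by auto
    moreover have "p (sub i (n w) (ev_rest L n h \<tau> i a))"
      using v va fr ia by (auto simp: ev_upd)
    ultimately have "p (sub i (n w') (ev_rest L n h \<tau> i a))"
      using sub_diag_le[OF fr(2) ia(1)] ev_rest_closed[OF fr(1) ia(2)] by blast
    then show ?thesis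
      using v fr ia by (auto simp: ev_upd)
  qed
  define \<rho> where "\<rho> w = (SOME w'. E w w')" for w
  have E_\<rho>: "E w (\<rho> w)" for w
    unfolding \<rho>_def by (rule someI, rule E_refl)
  have \<rho>_eq: "\<rho> w = \<rho> w' \<longleftrightarrow> E w w'" for w w'
  proof
    assume "\<rho> w = \<rho> w'"
    then show "E w w'"
      using E_\<rho>[of w] E_\<rho>[of w'] E_sym E_trans by metis
  next
    assume "E w w'"
    then have "E w = E w'"
      using E_sym E_trans by blast
    then show "\<rho> w = \<rho> w'"
      by (simp add: \<rho>_def)
  qed
  have \<rho>_idem: "\<rho> u = u" if "u \<in> range \<rho>" for u
    using that \<rho>_eq E_\<rho> by (metis rangeE)
  \<comment> \<open>\<open>v_subst\<close> replaces a name at one coordinate only, so a sequence of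
    representatives is read through a fixed choice of names. At \<open>i\<close> the representative
    of \<open>Base i\<close> is read as \<open>Base i\<close>; thus the sequence of these
    representatives is read as \<open>Base\<close> on \<open>I\<close>.\<close>
  define r where "r i u = (if u = \<rho> (Base i) then Base i else u)" for i u
  have \<rho>_r: "\<rho> (r i u) = u" if "u \<in> range \<rho>" for i u
    using \<rho>_idem[OF that] by (auto simp only: r_def split: if_splits)
  define rep where "rep s i = r i (s i)" for s i
  define f where "f a = {s \<in> I \<rightarrow>\<^sub>E range \<rho>. v (rep s, a)}" for a
  have rep_upd: "rep (s(i := u)) = (rep s)(i := r i u)" for s i u
    by (auto simp: rep_def)
  have f_cyl: "f (cyl A i a) = {s \<in> I \<rightarrow>\<^sub>E range \<rho>. \<exists>u. s(i := u) \<in> f a}" if ia: "i \<in> I" "a \<in> carrier A" for i a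
  proof -
    have "v (rep s, cyl A i a) \<longleftrightarrow> (\<exists>u. s(i := u) \<in> f a)" if s: "s \<in> I \<rightarrow>\<^sub>E range \<rho>" for s
    proof
      assume "v (rep s, cyl A i a)"
      \<comment> \<open>The witness is named by the sequence actually read, \<open>rep s\<close>;
        passing to its representative afterwards changes one coordinate only.\<close>
      then have "v ((rep s)(i := Wit (rep s) i a), a)"
        using v_wit ia by blast
      moreover have "E (Wit (rep s) i a) (r i (\<rho> (Wit (rep s) i a)))"
        using \<rho>_r \<rho>_eq by (metis rangeI)
      ultimately have "v (rep (s(i := \<rho> (Wit (rep s) i a))), a)"
        using v_subst ia unfolding rep_upd by blast
      moreover have "s(i := \<rho> (Wit (rep s) i a)) \<in> I \<rightarrow>\<^sub>E range \<rho>"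
        using s ia by (auto simp: PiE_iff extensional_def)
      ultimately show "\<exists>u. s(i := u) \<in> f a"
        unfolding f_def by blast
    next
      assume "\<exists>u. s(i := u) \<in> f a"
      then show "v (rep s, cyl A i a)"
        using v_cyl ia by (auto simp: f_def rep_upd)
    qed
    then show ?thesis
      by (auto simp: f_def)
  qed
  have f_diag: "f (diag A i j) = {s \<in> I \<rightarrow>\<^sub>E range \<rho>. s i = s j}" if ij: "i \<in> I" "j \<in> I" for i j
  proof -
    have "v (rep s, diag A i j) \<longleftrightarrow> s i = s j" if "s \<in> I \<rightarrow>\<^sub>E range \<rho>" for s
    proof -
      have "s i \<in> range \<rho>" "s j \<in> range \<rho>"
        using that ij by auto
      then show ?thesis
        using E_diag[OF ij] \<rho>_eq[of "rep s i" "rep s j"] \<rho>_r by (simp add: rep_def)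
    qed
    then show ?thesis
      by (auto simp: f_def)
  qed
  have "represents I A (range \<rho>) f"
    unfolding represents_def using f_cyl f_diag v_join v_compl by (auto simp: f_def)
  moreover have "f x \<noteq> {}"
  proof -
    let ?s = "restrict (\<lambda>i. \<rho> (Base i)) I"
    have agree: "rep ?s i = Base i" if "i \<in> I" for i
      using that by (simp add: rep_def r_def)
    let ?F = "{(Base, x), (rep ?s, x)}"
    obtain L n h p where fr: "frame L n h" and v: "\<forall>(\<tau>, a)\<in>?F. v (\<tau>, a) \<longleftrightarrow> p (ev L n h \<tau> a)"
      using approx[of "{}" ?F] by auto
    \<comment> \<open>Agreement on \<open>I\<close> suffices, because \<open>ev\<close> looks only
      at the coordinates in \<open>L\<close>.\<close>
    have "ev L n h (rep ?s) x = ev L n h Base x"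
      unfolding ev_def using fr agree by (intro subs_cong) (auto simp: frame_def)
    then have "v (rep ?s, x)"
      using v v_Base by auto
    then have "?s \<in> f x"
      by (auto simp: f_def)
    then show ?thesis
      by blast
  qed
  ultimately show ?thesis
    by blast
qed

end

section \<open>Bounding the number of names, to fix the base type\<close>

text \<open>A name is a well-founded tree branching over the indices, coded by its set of finite
  paths: \<open>c 0\<close> marks a leaf, \<open>c 1\<close> the label of a node, \<open>c 2\<close>
  a path continuing into branch \<open>k\<close>.\<close>

primrec code :: "('t \<Rightarrow> 't \<Rightarrow> 't) \<Rightarrow> (nat \<Rightarrow> 't) \<Rightarrow> ('i \<Rightarrow> 't) \<Rightarrow> ('a \<Rightarrow> 't) \<Rightarrow> ('i, 'a) nm \<Rightarrow> 't set"
  where "code P c I A (Base i) = {P (c 0) (I i)}"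
  | "code P c I A (Wit \<tau> i a) = {P (c 1) (P (I i) (A a))} \<union> {P (c 2) (P (I k) t) | k t. t \<in> code P c I A (\<tau> k)}"

lemma code_inj:
  assumes P: "\<And>a b c d. P a b = P c d \<longleftrightarrow> a = c \<and> b = d" and c: "inj c" and "inj I" and "inj A"
  shows "code P c I A w = code P c I A w' \<Longrightarrow> w = w'"
proof (induction w arbitrary: w')
  case (Base i)
  have "c 0 \<noteq> c 1"
    using c by (auto dest: injD)
  then show ?case
    using Base P \<open>inj I\<close> by (cases w') (auto dest: injD)
next
  case (Wit \<tau> i a)
  have cs: "c 0 \<noteq> c 1" "c 1 \<noteq> c 2" "c 0 \<noteq> c 2"
    using c by (auto dest: injD)
  obtain \<tau>' i' a' where w': "w' = Wit \<tau>' i' a'"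
  proof (cases w')
    case (Base j)
    have "P (c 1) (P (I i) (A a)) \<in> code P c I A w'"
      unfolding Wit.prems[symmetric] by simp
    then show ?thesis
      using Base P cs by simp
  qed
  have "P (c 1) (P (I i) (A a)) \<in> code P c I A w'"
    unfolding Wit.prems[symmetric] by simp
  then have ia: "i' = i" "a' = a"
    using w' P cs \<open>inj I\<close> \<open>inj A\<close> by (auto dest: injD)
  have mem: "t \<in> code P c I A (\<tau> k) \<longleftrightarrow> P (c 2) (P (I k) t) \<in> code P c I A (Wit \<tau> i a)" for \<tau> k t i a
    using P cs \<open>inj I\<close> by (auto dest: injD)
  have "\<tau> k = \<tau>' k" for k
  proof (rule Wit.IH)
    show "code P c I A (\<tau> k) = code P c I A (\<tau>' k)"
      using Wit.prems mem[of _ \<tau> k i a] mem[of _ \<tau>' k i' a'] unfolding w' by blast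
  qed auto
  then show ?case
    using w' ia by auto
qed

lemma ex_inj_names:
  assumes "infinite (UNIV :: 'i set)"
  shows "\<exists>g :: 'a \<times> ('i, 'a) nm \<Rightarrow> ('a + 'i) set set. inj g"
proof -
  have inf: "infinite (UNIV :: ('a + 'i) set)"
  proof -
    have "infinite (range (Inr :: 'i \<Rightarrow> 'a + 'i))"
      using assms by (simp add: finite_image_iff)
    then show ?thesis
      using finite_subset[OF subset_UNIV] by auto
  qed
  obtain P :: "'a + 'i \<Rightarrow> 'a + 'i \<Rightarrow> 'a + 'i" where P: "\<And>a b c d. P a b = P c d \<longleftrightarrow> a = c \<and> b = d"
    using ex_pairing[OF inf] by metis
  obtain c :: "nat \<Rightarrow> 'a + 'i" where c: "inj c"
    using infinite_countable_subset[OF inf] by auto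
  let ?code = "code P c Inr Inl"
  have inj: "w = w'" if "?code w = ?code w'" for w w' :: "('i, 'a) nm"
    using code_inj[of P c Inr Inl, OF P c _ _ that] by simp
  have ne: "?code w \<noteq> {}" for w :: "('i, 'a) nm"
    by (cases w) auto
  \<comment> \<open>The tag \<open>Inl x\<close>, readable because codes are nonempty, keeps the
    bases for different \<open>x\<close> disjoint. The singleton lifts the code to the base type of
    the statement.\<close>
  define g :: "'a \<times> ('i, 'a) nm \<Rightarrow> ('a + 'i) set set" where "g = (\<lambda>(x, w). {P (Inl x) ` ?code w})"
  have "x = x' \<and> w = w'" if "P (Inl x) ` ?code w = P (Inl x') ` ?code w'" for x x' and w w' :: "('i, 'a) nm"
  proof -
    obtain t where "t \<in> ?code w"
      using ne by blast
    then have "P (Inl x) t \<in> P (Inl x') ` ?code w'"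
      using that by blast
    then have x: "x = x'"
      using P by auto
    moreover have "inj (P (Inl x'))"
      using P by (auto intro: injI)
    ultimately have "?code w = ?code w'"
      using that inj_image_eq_iff by metis
    then show ?thesis
      using x inj by blast
  qed
  then have "inj g"
    unfolding g_def by (intro injI) (auto split: prod.splits)
  then show ?thesis
    by blast
qed

lemma represents_inj_image:
  assumes f: "represents I A U f" and g: "inj_on g U" and fx: "f x \<noteq> {}" "x \<in> carrier A"
    and closed: "closed_under I A (carrier A)"
  shows "\<exists>f'. represents I A (g ` U) f' \<and> f' x \<noteq> {}"
proof -
  define \<gamma> where "\<gamma> s = restrict (\<lambda>k. inv_into U g (s k)) I" for s
  define f' where "f' a = {s \<in> I \<rightarrow>\<^sub>E g ` U. \<gamma> s \<in> f a}" for a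
  have \<gamma>: "\<gamma> s \<in> I \<rightarrow>\<^sub>E U" if "s \<in> I \<rightarrow>\<^sub>E g ` U" for s
    using that by (auto simp: \<gamma>_def PiE_iff intro: inv_into_into)
  have \<gamma>_upd: "\<gamma> (s(i := u)) = (\<gamma> s)(i := inv_into U g u)" if "i \<in> I" for s i u
    using that by (auto simp: \<gamma>_def)
  have sub: "f a \<subseteq> I \<rightarrow>\<^sub>E U" if "a \<in> carrier A" for a
    using f that by (simp add: represents_def)
  have f'_cyl: "f' (cyl A i a) = {s \<in> I \<rightarrow>\<^sub>E g ` U. \<exists>u. s(i := u) \<in> f' a}" if ia: "i \<in> I" "a \<in> carrier A" for i a
  proof -
    have "\<gamma> s \<in> f (cyl A i a) \<longleftrightarrow> (\<exists>u. s(i := u) \<in> f' a)" if s: "s \<in> I \<rightarrow>\<^sub>E g ` U" for s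
    proof -
      have "\<gamma> s \<in> f (cyl A i a) \<longleftrightarrow> (\<exists>u. (\<gamma> s)(i := u) \<in> f a)"
        using f ia \<gamma>[OF s] by (simp add: represents_def)
      also have "\<dots> \<longleftrightarrow> (\<exists>u. s(i := u) \<in> f' a)"
      proof
        assume "\<exists>u. (\<gamma> s)(i := u) \<in> f a"
        then obtain u where u: "(\<gamma> s)(i := u) \<in> f a"
          by blast
        then have "(\<gamma> s)(i := u) \<in> I \<rightarrow>\<^sub>E U"
          using sub ia by blast
        then have "u \<in> U"
          using ia(1) by (metis PiE_mem fun_upd_same)
        then have "s(i := g u) \<in> I \<rightarrow>\<^sub>E g ` U" "\<gamma> (s(i := g u)) = (\<gamma> s)(i := u)"
          using s ia(1) g \<gamma>_upd by (auto simp: PiE_iff extensional_def)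
        then show "\<exists>u. s(i := u) \<in> f' a"
          using u by (intro exI[of _ "g u"]) (simp add: f'_def)
      next
        assume "\<exists>u. s(i := u) \<in> f' a"
        then show "\<exists>u. (\<gamma> s)(i := u) \<in> f a"
          using ia \<gamma>_upd by (auto simp: f'_def)
      qed
      finally show ?thesis .
    qed
    then show ?thesis
      by (auto simp: f'_def)
  qed
  have f'_diag: "f' (diag A i j) = {s \<in> I \<rightarrow>\<^sub>E g ` U. s i = s j}" if ij: "i \<in> I" "j \<in> I" for i j
  proof -
    have "\<gamma> s i = \<gamma> s j \<longleftrightarrow> s i = s j" if "s \<in> I \<rightarrow>\<^sub>E g ` U" for s
    proof -
      have "s i \<in> g ` U" "s j \<in> g ` U"
        using that ij by auto
      then show ?thesis
        using ij inv_into_injective[of U g "s i" "s j"] by (auto simp: \<gamma>_def)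
    qed
    then show ?thesis
      using f ij \<gamma> by (auto simp: f'_def represents_def)
  qed
  have f'_join: "f' (join A a b) = f' a \<union> f' b" if "a \<in> carrier A" "b \<in> carrier A" for a b
    using f that by (auto simp: f'_def represents_def)
  have f'_compl: "f' (compl A a) = (I \<rightarrow>\<^sub>E g ` U) - f' a" if "a \<in> carrier A" for a
    using f that \<gamma> by (auto simp: f'_def represents_def)
  have f'_sub: "f' a \<subseteq> I \<rightarrow>\<^sub>E g ` U" for a
    by (auto simp: f'_def)
  have "represents I A (g ` U) f'"
    unfolding represents_def by (intro conjI ballI f'_cyl f'_diag f'_join f'_compl f'_sub)
  moreover have "f' x \<noteq> {}"
  proof -
    obtain s where s: "s \<in> f x" "s \<in> I \<rightarrow>\<^sub>E U"
      using fx sub by blast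
    let ?s = "restrict (\<lambda>k. g (s k)) I"
    have "?s \<in> I \<rightarrow>\<^sub>E g ` U"
      using s(2) by auto
    moreover have "\<gamma> ?s = s"
    proof
      fix k
      show "\<gamma> ?s k = s k"
        using s(2) g by (cases "k \<in> I") (auto simp: \<gamma>_def PiE_iff extensional_def)
    qed
    ultimately have "?s \<in> f' x"
      using s(1) by (simp add: f'_def)
    then show ?thesis
      by blast
  qed
  ultimately show ?thesis
    by blast
qed

section \<open>Gluing together one square for each nonzero element\<close>

lemma Iso_Sub_Edc_subset_RCA:
  fixes I :: "'i set"
  assumes inf: "infinite I"
  shows "(Iso I (Sub I (Edc I :: ('b, 'i) cyl_structure set)) :: ('a, 'i) cyl_structure set)
    \<subseteq> RCA TYPE(('a + 'i) set set) I"
proof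
  fix A :: "('a, 'i) cyl_structure" assume "A \<in> Iso I (Sub I (Edc I :: ('b, 'i) cyl_structure set))"
  then obtain B :: "('b, 'i) cyl_structure" and S where B: "B \<in> Edc I" "S \<subseteq> carrier B"
    and iso: "cyl_iso I A (B\<lparr>carrier := S\<rparr>)"
    unfolding Iso_def Sub_def by blast
  then obtain \<iota> where \<iota>: "\<iota> \<in> cyl_hom I A (B\<lparr>carrier := S\<rparr>)" "inj_on \<iota> (carrier A)"
    and A: "carrier A \<noteq> {}" "closed_under I A (carrier A)"
    by (auto simp: cyl_iso_def cyl_type_algebra_def bij_betw_def)
  interpret cylindric_algebra I B
    using B(1) by (simp add: Edc_def)
  interpret edc_extension I B A \<iota>
  proof
    show "\<iota> \<in> cyl_hom I A B"
      using \<iota>(1) B(2) by (auto simp: cyl_hom_def)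
  qed (use inf B A in \<open>auto simp: Edc_def\<close>)
  have \<iota>_simps: "\<iota> a \<in> carrier B" "\<iota> (compl A a) = \<sim>\<^bsub>B\<^esub> \<iota> a" if "a \<in> carrier A" for a
    using hom that by (auto simp: cyl_hom_def)
  have \<iota>_join: "\<iota> (join A a b) = \<iota> a \<oplus>\<^bsub>B\<^esub> \<iota> b" if "a \<in> carrier A" "b \<in> carrier A" for a b
    using hom that by (auto simp: cyl_hom_def)
  have "infinite (UNIV :: 'i set)"
    using inf finite_subset[OF subset_UNIV] by auto
  from ex_inj_names[OF this] obtain g :: "'a \<times> ('i, 'a) nm \<Rightarrow> ('a + 'i) set set" where g: "inj g" ..
  define X where "X = {x \<in> carrier A. \<iota> x \<noteq> \<zero>\<^bsub>B\<^esub>}"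
  \<comment> \<open>Each square need only keep its own \<open>x\<close> nonempty; faithfulness comes
    from all of them together.\<close>
  have "\<exists>U f. represents I A U f \<and> f x \<noteq> {} \<and> U \<subseteq> g ` ({x} \<times> UNIV)" if x: "x \<in> X" for x
  proof -
    have "x \<in> carrier A" "\<iota> x \<noteq> \<zero>\<^bsub>B\<^esub>"
      using x by (auto simp: X_def)
    from ex_representation[OF this] obtain U :: "('i, 'a) nm set" and f
      where f: "represents I A U f" "f x \<noteq> {}"
      by (elim exE conjE) (rule that)
    have "inj_on (\<lambda>w. g (x, w)) U"
      using g by (auto simp: inj_on_def)
    then obtain f' where "represents I A ((\<lambda>w. g (x, w)) ` U) f'" "f' x \<noteq> {}"
      using represents_inj_image[OF f(1) _ f(2) _ A(2)] x by (auto simp: X_def)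
    then show ?thesis
      by (intro exI[of _ "(\<lambda>w. g (x, w)) ` U"] exI[of _ f']) auto
  qed
  then obtain U f where rep: "\<And>x. x \<in> X \<Longrightarrow> represents I A (U x) (f x)"
    and ne: "\<And>x. x \<in> X \<Longrightarrow> f x x \<noteq> {}" and Ug: "\<And>x. x \<in> X \<Longrightarrow> U x \<subseteq> g ` ({x} \<times> UNIV)"
    by metis
  have f_sub: "f x a \<subseteq> I \<rightarrow>\<^sub>E U x" if "x \<in> X" "a \<in> carrier A" for x a
    using rep[OF that(1)] that(2) by (simp add: represents_def)
  obtain i0 where i0: "i0 \<in> I"
    using inf by fastforce
  have U_disj: "x = y" if xy: "x \<in> X" "y \<in> X" "u \<in> U x" "u \<in> U y" for x y u
  proof -
    obtain w w' where "u = g (x, w)" "u = g (y, w')"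
      using Ug[OF xy(1)] Ug[OF xy(2)] xy(3,4) by blast
    then show ?thesis
      using g by (auto dest: injD)
  qed
  have sq_disj: "x = y" if "x \<in> X" "y \<in> X" "s \<in> I \<rightarrow>\<^sub>E U x" "s \<in> I \<rightarrow>\<^sub>E U y" for x y s
    using U_disj[OF that(1,2), of "s i0"] that i0 by auto
  interpret cs: cyl_set_unit I "U ` X"
  proof
    show "disjoint ((\<lambda>U. I \<rightarrow>\<^sub>E U) ` (U ` X))"
      using sq_disj by (intro disjointI) blast
  qed (rule inf)
  define F where "F a = (\<Union>x\<in>X. f x a)" for a
  have F_mem: "s \<in> F a \<longleftrightarrow> s \<in> f x a" if "x \<in> X" "s \<in> I \<rightarrow>\<^sub>E U x" "a \<in> carrier A" for x s a
  proof
    assume "s \<in> F a"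
    then obtain y where y: "y \<in> X" "s \<in> f y a"
      unfolding F_def by blast
    then have "s \<in> I \<rightarrow>\<^sub>E U y"
      using f_sub[OF y(1) that(3)] by blast
    then show "s \<in> f x a"
      using sq_disj[OF that(1) y(1) that(2)] y(2) by simp
  qed (use that(1) in \<open>auto simp: F_def\<close>)
  have V_mem: "s \<in> cs.V \<longleftrightarrow> (\<exists>x\<in>X. s \<in> I \<rightarrow>\<^sub>E U x)" for s
    by (auto simp: cs.V_def)
  have F_V: "F a \<subseteq> cs.V" if "a \<in> carrier A" for a
  proof
    fix s assume "s \<in> F a"
    then obtain y where y: "y \<in> X" "s \<in> f y a"
      unfolding F_def by blast
    then have "s \<in> I \<rightarrow>\<^sub>E U y"
      using subsetD[OF f_sub[OF y(1) that]] by simp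
    then show "s \<in> cs.V"
      unfolding V_mem using y(1) by (rule bexI)
  qed
  have F_eqI: "F a = Y" if a: "a \<in> carrier A" and Y: "Y \<subseteq> cs.V"
    and eq: "\<And>x s. \<lbrakk>x \<in> X; s \<in> I \<rightarrow>\<^sub>E U x\<rbrakk> \<Longrightarrow> s \<in> f x a \<longleftrightarrow> s \<in> Y" for a Y
  proof -
    have "s \<in> F a \<longleftrightarrow> s \<in> Y" if "s \<in> cs.V" for s
    proof -
      from \<open>s \<in> cs.V\<close> obtain x where x: "x \<in> X" "s \<in> I \<rightarrow>\<^sub>E U x"
        unfolding V_mem by (rule bexE)
      then show ?thesis
        using F_mem[OF x a] eq[OF x] by simp
    qed
    then show ?thesis
      using F_V[OF a] Y by blast
  qed
  have F_hom: "F \<in> cyl_hom I A cs.\<A>"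
    unfolding cyl_hom_def
  proof (intro CollectI conjI ballI Pi_I)
    fix a assume a: "a \<in> carrier A"
    show "F a \<in> carrier cs.\<A>"
      using F_V[OF a] by simp
    show "F (compl A a) = compl cs.\<A> (F a)"
    proof (rule F_eqI)
      fix x s assume x: "x \<in> X" "s \<in> I \<rightarrow>\<^sub>E U x"
      then show "s \<in> f x (compl A a) \<longleftrightarrow> s \<in> compl cs.\<A> (F a)"
        using rep[OF x(1)] a F_mem[OF x a] V_mem by (auto simp: represents_def)
    qed (use a in auto)
    fix b assume b: "b \<in> carrier A"
    show "F (join A a b) = join cs.\<A> (F a) (F b)"
    proof (rule F_eqI)
      fix x s assume x: "x \<in> X" "s \<in> I \<rightarrow>\<^sub>E U x"
      then show "s \<in> f x (join A a b) \<longleftrightarrow> s \<in> join cs.\<A> (F a) (F b)"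
        using rep[OF x(1)] a b F_mem[OF x a] F_mem[OF x b] by (auto simp: represents_def)
    qed (use a b F_V in auto)
  next
    fix i a assume i: "i \<in> I" and a: "a \<in> carrier A"
    show "F (cyl A i a) = cyl cs.\<A> i (F a)"
    proof (rule F_eqI)
      fix x s assume x: "x \<in> X" "s \<in> I \<rightarrow>\<^sub>E U x"
      have "s(i := u) \<in> f x a \<longleftrightarrow> s(i := u) \<in> F a" for u
      proof
        assume "s(i := u) \<in> f x a"
        then show "s(i := u) \<in> F a"
          using x unfolding F_def by blast
      next
        assume su: "s(i := u) \<in> F a"
        then have "s(i := u) \<in> cs.V"
          using F_V[OF a] by blast
        then have "u \<in> U x"
          using cs.upd_in_square[OF x(2) _ i] x(1) by blast
        then have "s(i := u) \<in> I \<rightarrow>\<^sub>E U x"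
          using x(2) i by (auto simp: PiE_iff extensional_def)
        then show "s(i := u) \<in> f x a"
          using F_mem[OF x(1) _ a] su by blast
      qed
      moreover have "s \<in> cs.V"
        unfolding V_mem using x(2,1) by (rule bexI)
      ultimately show "s \<in> f x (cyl A i a) \<longleftrightarrow> s \<in> cyl cs.\<A> i (F a)"
        using rep[OF x(1)] x(2) i a unfolding cs.cyl_full[OF i F_V[OF a]] by (simp add: represents_def)
    qed (use i a F_V cs.cyl_full_subset in auto)
  next
    fix i j assume ij: "i \<in> I" "j \<in> I"
    show "F (diag A i j) = diag cs.\<A> i j"
    proof (rule F_eqI)
      fix x s assume x: "x \<in> X" "s \<in> I \<rightarrow>\<^sub>E U x"
      then show "s \<in> f x (diag A i j) \<longleftrightarrow> s \<in> diag cs.\<A> i j"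
        using rep[OF x(1)] ij V_mem by (auto simp: represents_def)
    qed (use ij in auto)
  qed
  have sep: "\<exists>s. s \<in> F a \<and> s \<notin> F b" if ab: "a \<in> carrier A" "b \<in> carrier A" and p: "point p" "p (\<iota> a)" "\<not> p (\<iota> b)" for a b p
  proof -
    \<comment> \<open>The difference of \<open>a\<close> and \<open>b\<close> in the operations of
      \<open>A\<close>. Its image is nonzero since \<open>p\<close> holds there, so its own square
      contains a sequence in \<open>F a\<close> but not in \<open>F b\<close>.\<close>
    let ?z = "compl A (join A (compl A a) b)"
    have z: "?z \<in> carrier A"
      using ab by simp
    have "p (\<iota> ?z)"
      using ab p by (simp add: \<iota>_simps \<iota>_join)
    then have zX: "?z \<in> X"
      using z p(1) by (auto simp: X_def)
    obtain s where s: "s \<in> f ?z ?z"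
      using ne[OF zX] by blast
    have sq: "s \<in> I \<rightarrow>\<^sub>E U ?z"
      using s f_sub[OF zX z] by blast
    have "s \<in> f ?z a" "s \<notin> f ?z b"
      using s sq rep[OF zX] ab by (auto simp: represents_def)
    then show ?thesis
      using F_mem[OF zX sq] ab by blast
  qed
  have F_inj: "inj_on F (carrier A)"
  proof (rule inj_onI)
    fix a b assume ab: "a \<in> carrier A" "b \<in> carrier A" "F a = F b"
    have "\<iota> a = \<iota> b"
    proof (rule eq_by_points)
      fix p assume "point p"
      then show "p (\<iota> a) \<longleftrightarrow> p (\<iota> b)"
        using sep[OF ab(1,2)] sep[OF ab(2,1)] ab(3) by blast
    qed (use ab \<iota>_simps in auto)
    then show "a = b"
      using \<iota>(2) ab by (auto dest: inj_onD)
  qed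
  let ?S = "F ` carrier A"
  have S: "?S \<noteq> {}" "?S \<subseteq> carrier cs.\<A>"
    using A F_V by auto
  have closed_S: "closed_under I cs.\<A> ?S"
    unfolding closed_under_def
  proof (intro conjI ballI)
    fix i Y assume "i \<in> I" "Y \<in> ?S"
    then obtain a where "a \<in> carrier A" "Y = F a"
      by blast
    then have "cyl cs.\<A> i Y = F (cyl A i a)"
      using F_hom \<open>i \<in> I\<close> by (simp add: cyl_hom_def)
    then show "cyl cs.\<A> i Y \<in> ?S"
      using \<open>a \<in> carrier A\<close> \<open>i \<in> I\<close> by simp
  next
    fix i j assume ij: "i \<in> I" "j \<in> I"
    then have "diag cs.\<A> i j = F (diag A i j)"
      using F_hom unfolding cyl_hom_def by simp
    then show "diag cs.\<A> i j \<in> ?S"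
      using ij by simp
  next
    fix Y Z assume "Y \<in> ?S" "Z \<in> ?S"
    then obtain a b where ab: "a \<in> carrier A" "Y = F a" "b \<in> carrier A" "Z = F b"
      by blast
    then have "join cs.\<A> Y Z = F (join A a b)"
      using F_hom unfolding cyl_hom_def by simp
    then show "join cs.\<A> Y Z \<in> ?S"
      using ab by simp
  next
    fix Y assume "Y \<in> ?S"
    then obtain a where a: "a \<in> carrier A" "Y = F a"
      by blast
    then have "compl cs.\<A> Y = F (compl A a)"
      using F_hom unfolding cyl_hom_def by simp
    then show "compl cs.\<A> Y \<in> ?S"
      using a by simp
  qed
  have "cyl_iso I A (cs.\<A>\<lparr>carrier := ?S\<rparr>)"
    unfolding cyl_iso_def
  proof (intro conjI bexI[of _ F])
    show "cyl_type_algebra I (cs.\<A>\<lparr>carrier := ?S\<rparr>)"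
      using S closed_S by (simp add: cyl_type_algebra_def closed_under_def)
    show "cyl_type_algebra I A"
      using A by (simp add: cyl_type_algebra_def)
    show "bij_betw F (carrier A) (carrier (cs.\<A>\<lparr>carrier := ?S\<rparr>))"
      using F_inj by (simp add: bij_betw_def)
    show "F \<in> cyl_hom I A (cs.\<A>\<lparr>carrier := ?S\<rparr>)"
      using F_hom by (auto simp: cyl_hom_def)
  qed
  moreover have "cs.\<A>\<lparr>carrier := ?S\<rparr> \<in> Sub I
    {full_cyl_set_algebra (\<Union>\<U>) (\<Union>U\<in>\<U>. I \<rightarrow>\<^sub>E U) | \<U> :: ('a + 'i) set set set set.
      disjoint ((\<lambda>U. I \<rightarrow>\<^sub>E U) ` \<U>)}"
    unfolding Sub_def mem_Collect_eq
  proof (intro exI conjI)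
    show "cs.\<A>\<lparr>carrier := ?S\<rparr> = cs.\<A>\<lparr>carrier := ?S\<rparr>" ..
    show "cs.\<A> = full_cyl_set_algebra (\<Union>(U ` X)) (\<Union>U\<in>U ` X. I \<rightarrow>\<^sub>E U)"
      by (simp add: cs.\<A>_def cs.V_def)
  qed (use cs.disjoint_squares S closed_S in auto)
  ultimately show "A \<in> RCA TYPE(('a + 'i) set set) I"
    unfolding RCA_def Iso_def by blast
qed

text \<open>A class over all carrier types is no single set, so each inclusion fixes its types.
  Equality is stated where both inclusions meet: for base type \<open>('a + 'i) set set\<close> and
  the carrier type of the set algebras over it.\<close>

theorem theorem4p2:
  fixes \<alpha> :: "'i rel"
  assumes "Well_order \<alpha>" and "infinite (Field \<alpha>)"
  shows
    "(\<exists>A :: (('i \<Rightarrow> 'i set) set, 'i) cyl_structure.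
        A \<in> RCA TYPE('i set) (Field \<alpha>) \<and> A \<notin> Edc (Field \<alpha>)) \<and>
     (Edc (Field \<alpha>) :: ('a, 'i) cyl_structure set)
       \<subseteq> Iso (Field \<alpha>) (Sub (Field \<alpha>) (Edc (Field \<alpha>) :: ('a, 'i) cyl_structure set)) \<and>
     (Edc (Field \<alpha>) :: (('i \<Rightarrow> 'i set) set, 'i) cyl_structure set)
       \<subset> Iso (Field \<alpha>) (Sub (Field \<alpha>) (Edc (Field \<alpha>) :: (('i \<Rightarrow> 'i set) set, 'i) cyl_structure set)) \<and>
     (Iso (Field \<alpha>) (Sub (Field \<alpha>) (Edc (Field \<alpha>) :: ('b, 'i) cyl_structure set))
         :: ('a, 'i) cyl_structure set)
       \<subseteq> RCA TYPE(('a + 'i) set set) (Field \<alpha>) \<and>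
     (RCA TYPE('u) (Field \<alpha>) :: ('a, 'i) cyl_structure set)
       \<subseteq> Iso (Field \<alpha>) (Sub (Field \<alpha>) (Edc (Field \<alpha>) :: (('i \<Rightarrow> 'u) set, 'i) cyl_structure set)) \<and>
     (Iso (Field \<alpha>) (Sub (Field \<alpha>)
           (Edc (Field \<alpha>) :: (('i \<Rightarrow> ('a + 'i) set set) set, 'i) cyl_structure set))
         :: ('a, 'i) cyl_structure set)
       = RCA TYPE(('a + 'i) set set) (Field \<alpha>)"
proof -
  let ?I = "Field \<alpha>"
  note inf = assms(2)
  have ex: "\<exists>A :: (('i \<Rightarrow> 'i set) set, 'i) cyl_structure. A \<in> RCA TYPE('i set) ?I \<and> A \<notin> Edc ?I"
    using RCA_not_subset_Edc[OF inf] .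
  have "(Edc ?I :: (('i \<Rightarrow> 'i set) set, 'i) cyl_structure set)
      \<noteq> Iso ?I (Sub ?I (Edc ?I :: (('i \<Rightarrow> 'i set) set, 'i) cyl_structure set))"
    using ex RCA_subset_Iso_Sub_Edc[OF inf, where ?'u = "'i set" and ?'a = "('i \<Rightarrow> 'i set) set"] by blast
  then show ?thesis
    by (intro conjI ex psubsetI equalityI Edc_subset_Iso_Sub_Edc Iso_Sub_Edc_subset_RCA[OF inf]
        RCA_subset_Iso_Sub_Edc[OF inf])
qed

end
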